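(* For all $p,q,r\ge 0$ with $n=p+q+r\ge 1$: (i) $\Gamma^{0n}_{p,q,r}=\Gamma^{n}_{p,q,r}$, and this group equals $\mathcal{G}^{\times}_{p,q,r}$ if $n$ is odd and $\mathrm{P}^{\pm\mathrm{rad}}_{p,q,r}$ if $n$ is even; (ii) $\check{\Gamma}^{0n}_{p,q,r}=\mathrm{P}_{p,q,r}$; (iii) $\tilde{\Gamma}^{0n}_{p,q,r}=\mathrm{P}_{p,q,0}$ if $n$ is odd and $r=0$, and $\tilde{\Gamma}^{0n}_{p,q,r}=\mathrm{P}^{\pm\mathrm{rad}}_{p,q,r}$ in the other cases.
   Context: Let $\mathbb{F}=\mathbb{R}$ or $\mathbb{F}=\mathbb{C}$, let $p,q,r\ge 0$ be integers and $n=p+q+r\ge 1$. $\mathcal{G}_{p,q,r}$ denotes the (Clifford) geometric algebra: the unital associative $\mathbb{F}$-algebra of dimension $2^n$ with identity $e$ and generators $e_1,\dots,e_n$ satisfying $e_ae_b+e_be_a=2\eta_{ab}e$, where $\eta$ is the diagonal matrix whose diagonal is $p$ times $1$, then $q$ times $-1$, then $r$ times $0$ (if $\mathbb{F}=\mathbb{R}$), or $p+q$ times $1$, then $r$ times $0$ (if $\mathbb{F}=\mathbb{C}$). A basis is given by $e_{a_1\ldots a_k}:=e_{a_1}\cdots e_{a_k}$, $a_1<\dots<a_k$, $0\le k\le n$ (the empty product being $e$); $\mathcal{G}^k_{p,q,r}$ (grade $k$) is the span of those with $k$ indices, $\mathcal{G}^0=\mathbb{F}e$, and $\mathcal{G}^{0n}_{p,q,r}:=\mathcal{G}^0\oplus\mathcal{G}^n_{p,q,r}$.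 The grade involution $U\mapsto\widehat U$ is the algebra automorphism with $\widehat{e_a}=-e_a$. $\mathcal{G}^{(k)}_{p,q,r}=\{U:\widehat U=(-1)^kU\}$, $k=0,1$ (even and odd subspaces). $\Lambda_r=\mathcal{G}_{0,0,r}$ is the (Grassmann) subalgebra generated by $e$ and the null generators $e_{p+q+1},\dots,e_n$ ($\Lambda_0=\mathcal{G}^0$), and $\Lambda_r^{(0)}=\Lambda_r\cap\mathcal{G}^{(0)}_{p,q,r}$. $\mathrm{rad}\,\mathcal{G}_{p,q,r}$ is the Jacobson radical of $\mathcal{G}_{p,q,r}$; it is the span of the basis elements $e_{a_1\ldots a_k}$ containing at least one index from $\{p+q+1,\dots,n\}$ (it is $\{0\}$ if $r=0$). For a subset $A\subseteq\mathcal{G}_{p,q,r}$, $A^\times$ denotes the set of elements of $A$ invertible in $\mathcal{G}_{p,q,r}$. A product of subsets is the set of products of their elements. $\mathrm{Z}_{p,q,r}$ is the center of $\mathcal{G}_{p,q,r}$; it equals $\Lambda^{(0)}_r\oplus\mathcal{G}^n_{p,q,r}$ if $n$ is odd and $\Lambda^{(0)}_r$ if $n$ is even. Groups: $\mathrm{P}^{\pm}_{p,q,r}:=\mathcal{G}^{(0)\times}_{p,q,r}\cup\mathcal{G}^{(1)\times}_{p,q,r}$, $\mathrm{P}_{p,q,r}:=\mathrm{P}^{\pm}_{p,q,r}\mathrm{Z}^{\times}_{p,q,r}$, $\mathrm{P}^{\pm\mathrm{rad}}_{p,q,r}:=\mathrm{P}^{\pm}_{p,q,r}(\mathcal{G}^{0}\oplus\mathrm{rad}\,\mathcal{G}_{p,q,r})^{\times}$.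 For $T\in\mathcal{G}^\times_{p,q,r}$ and $U=U_0+U_1\in\mathcal{G}_{p,q,r}$ with $U_0\in\mathcal{G}^{(0)}_{p,q,r}$, $U_1\in\mathcal{G}^{(1)}_{p,q,r}$, set $\mathrm{ad}_T(U)=TUT^{-1}$, $\check{\mathrm{ad}}_T(U)=\widehat{T}UT^{-1}$, $\tilde{\mathrm{ad}}_T(U)=TU_0T^{-1}+\widehat{T}U_1T^{-1}$. $\Gamma^{n}_{p,q,r}:=\{T\in\mathcal{G}^\times_{p,q,r}:\mathrm{ad}_T(\mathcal{G}^{n}_{p,q,r})\subseteq\mathcal{G}^{n}_{p,q,r}\}$, $\Gamma^{0n}_{p,q,r}:=\{T\in\mathcal{G}^\times_{p,q,r}:\mathrm{ad}_T(\mathcal{G}^{0n}_{p,q,r})\subseteq\mathcal{G}^{0n}_{p,q,r}\}$, $\check{\Gamma}^{0n}_{p,q,r}:=\{T\in\mathcal{G}^\times_{p,q,r}:\check{\mathrm{ad}}_T(\mathcal{G}^{0n}_{p,q,r})\subseteq\mathcal{G}^{0n}_{p,q,r}\}$, $\tilde{\Gamma}^{0n}_{p,q,r}:=\{T\in\mathcal{G}^\times_{p,q,r}:\tilde{\mathrm{ad}}_T(\mathcal{G}^{0n}_{p,q,r})\subseteq\mathcal{G}^{0n}_{p,q,r}\}$. *)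

theory Defs
  imports Complex_Main "HOL-Library.Set_Algebras"
begin

section \<open>Units and the Jacobson radical of a (noncommutative) ring\<close>

definition ring_unit :: "'a::ring_1 \<Rightarrow> bool" where
  "ring_unit T \<longleftrightarrow> (\<exists>S. T * S = 1 \<and> S * T = 1)"

text \<open>Only meaningful on units.\<close>
definition ring_inv :: "'a::ring_1 \<Rightarrow> 'a" where
  "ring_inv T = (THE S. T * S = 1 \<and> S * T = 1)"

text \<open>The elements of \<open>A\<close> invertible in the whole ring; the inverse need not lie in \<open>A\<close>.\<close>
definition units_in :: "'a::ring_1 set \<Rightarrow> 'a set" where
  "units_in A = {T \<in> A. ring_unit T}"

definition ring_center :: "'a::ring_1 set" where
  "ring_center = {z. \<forall>x. z * x = x * z}"

definition left_ideal :: "'a::ring_1 set \<Rightarrow> bool" where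
  "left_ideal I \<longleftrightarrow> 0 \<in> I \<and> (\<forall>x\<in>I. \<forall>y\<in>I. x + y \<in> I) \<and> (\<forall>a. \<forall>x\<in>I. a * x \<in> I)"

definition maximal_left_ideal :: "'a::ring_1 set \<Rightarrow> bool" where
  "maximal_left_ideal M \<longleftrightarrow> left_ideal M \<and> M \<noteq> UNIV \<and>
     (\<forall>I. left_ideal I \<and> M \<subseteq> I \<and> I \<noteq> UNIV \<longrightarrow> I = M)"

definition jacobson_radical :: "'a::ring_1 set" where
  "jacobson_radical = \<Inter> {M. maximal_left_ideal M}"

section \<open>Geometric algebras\<close>

text \<open>Diagonals of the metric over the reals and over the complex numbers, indexed from 1.
  In dimension \<open>n = p + q + r\<close>, the indices \<open>p + q + 1, \<dots>, n\<close> belong to the null generators.\<close>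

definition real_metric :: "nat \<Rightarrow> nat \<Rightarrow> nat \<Rightarrow> real" where
  "real_metric p q a = (if a \<le> p then 1 else if a \<le> p + q then - 1 else 0)"

definition complex_metric :: "nat \<Rightarrow> nat \<Rightarrow> nat \<Rightarrow> complex" where
  "complex_metric p q a = (if a \<le> p + q then 1 else 0)"

text \<open>The whole type \<open>'a\<close> is the algebra and \<open>1\<close> is its identity. Only the values of the
  generators \<open>e\<close> and of the metric \<open>\<eta>\<close> at the indices \<open>1, \<dots>, n\<close> matter.\<close>

locale geometric_algebra = vector_space scale
  for scale :: "'f::field \<Rightarrow> 'a::ring_1 \<Rightarrow> 'a" (infixr \<open>*s\<close> 75) +
  fixes e :: "nat \<Rightarrow> 'a" and \<eta> :: "nat \<Rightarrow> 'f" and n :: nat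
  assumes scale_mult_left: "(c *s x) * y = c *s (x * y)"
    and scale_mult_right: "x * (c *s y) = c *s (x * y)"
    and dim_algebra: "dim UNIV = 2 ^ n"
    and generators: "\<And>S. subspace S \<Longrightarrow> 1 \<in> S \<Longrightarrow> (\<And>a. a \<in> {1..n} \<Longrightarrow> e a \<in> S) \<Longrightarrow>
        (\<And>x y. x \<in> S \<Longrightarrow> y \<in> S \<Longrightarrow> x * y \<in> S) \<Longrightarrow> S = UNIV"
    and relations: "\<And>a b. a \<in> {1..n} \<Longrightarrow> b \<in> {1..n} \<Longrightarrow>
        e a * e b + e b * e a = (if a = b then 2 * \<eta> a else 0) *s 1"
begin

text \<open>The product \<open>e\<^bsub>a\<^sub>1\<^esub> \<cdots> e\<^bsub>a\<^sub>k\<^esub>\<close> in increasing order of the indices, for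
  \<open>A = {a\<^sub>1 < \<dots> < a\<^sub>k}\<close>.\<close>
definition basis_elt :: "nat set \<Rightarrow> 'a" where
  "basis_elt A = prod_list (map e (sorted_list_of_set A))"

definition grade :: "nat \<Rightarrow> 'a set" where
  "grade k = span {basis_elt A | A. A \<subseteq> {1..n} \<and> card A = k}"

definition grade_0n :: "'a set" where
  "grade_0n = grade 0 + grade n"

definition hat :: "'a \<Rightarrow> 'a" where
  "hat = (THE f. Vector_Spaces.linear scale scale f \<and> bij f \<and> f 1 = 1 \<and>
     (\<forall>x y. f (x * y) = f x * f y) \<and> (\<forall>a\<in>{1..n}. f (e a) = - e a))"

text \<open>The even (\<open>k = 0\<close>) and odd (\<open>k = 1\<close>) subspaces.\<close>
definition parity_subspace :: "nat \<Rightarrow> 'a set" where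
  "parity_subspace k = {U. hat U = (- 1) ^ k * U}"

definition even_part :: "'a \<Rightarrow> 'a" where
  "even_part U = (THE U0. U0 \<in> parity_subspace 0 \<and> U - U0 \<in> parity_subspace 1)"

definition odd_part :: "'a \<Rightarrow> 'a" where
  "odd_part U = U - even_part U"

definition P_pm :: "'a set" where
  "P_pm = units_in (parity_subspace 0) \<union> units_in (parity_subspace 1)"

definition P :: "'a set" where
  "P = P_pm * units_in ring_center"

definition P_pm_rad :: "'a set" where
  "P_pm_rad = P_pm * units_in (grade 0 + jacobson_radical)"

definition ad :: "'a \<Rightarrow> 'a \<Rightarrow> 'a" where
  "ad T U = T * U * ring_inv T"

definition ad_check :: "'a \<Rightarrow> 'a \<Rightarrow> 'a" where
  "ad_check T U = hat T * U * ring_inv T"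

definition ad_tilde :: "'a \<Rightarrow> 'a \<Rightarrow> 'a" where
  "ad_tilde T U = T * even_part U * ring_inv T + hat T * odd_part U * ring_inv T"

definition Gamma_n :: "'a set" where
  "Gamma_n = {T \<in> units_in UNIV. ad T ` grade n \<subseteq> grade n}"

definition Gamma_0n :: "'a set" where
  "Gamma_0n = {T \<in> units_in UNIV. ad T ` grade_0n \<subseteq> grade_0n}"

definition Gamma_check_0n :: "'a set" where
  "Gamma_check_0n = {T \<in> units_in UNIV. ad_check T ` grade_0n \<subseteq> grade_0n}"

definition Gamma_tilde_0n :: "'a set" where
  "Gamma_tilde_0n = {T \<in> units_in UNIV. ad_tilde T ` grade_0n \<subseteq> grade_0n}"

end

end

theory Submission
  imports Defs
begin

text \<open>Let \<open>\<omega>\<close> be the pseudoscalar \<open>e\<^bsub>1\<dots>n\<^esub>\<close>. It is central if \<open>n\<close> is odd and satisfies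
  \<open>\<omega> T = hat T \<omega>\<close> if \<open>n\<close> is even, its square is a scalar, and its annihilator is the radical.
  Hence every condition on \<open>T\<close> turns into a relation between \<open>T\<close> and \<open>hat T\<close>: either
  \<open>hat T = c T\<close> modulo the radical, which forces the even or the odd part of \<open>T\<close> into the
  radical and so describes \<open>P_pm_rad\<close>, or \<open>hat T = (\<alpha> + \<beta> \<omega>) T\<close>. Comparing parities in the
  latter shows that, for \<open>n\<close> odd, \<open>T\<close> is a central multiple of its even or odd part, whereas
  \<open>\<beta> = 0\<close> for \<open>n\<close> even; so it describes \<open>P\<close>.

  The radical contains the nilpotent ideal generated by the null generators. Conversely, averaging
  over conjugation by the other generators moves any further element of the radical to
  \<open>1 + w\<close> with \<open>w\<^sup>2\<close> a scalar, and no such element can lie in the radical.\<close>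

section \<open>Units and the Jacobson radical\<close>

lemma ring_unitI:
  fixes T :: "'a::ring_1"
  assumes "S * T = 1" "T * R = 1"
  shows "ring_unit T"
proof -
  have "S = R"
    by (metis assms mult.assoc mult.right_neutral mult.left_neutral)
  then show ?thesis
    using assms unfolding ring_unit_def by blast
qed

lemma ring_inv_eqI:
  fixes T :: "'a::ring_1"
  assumes "T * S = 1" "S * T = 1"
  shows "ring_inv T = S"
  unfolding ring_inv_def
proof (rule the_equality)
  fix R assume "T * R = 1 \<and> R * T = 1"
  then show "R = S"
    by (metis assms(2) mult.assoc mult.right_neutral mult.left_neutral)
qed (use assms in blast)

lemma
  fixes T :: "'a::ring_1"
  assumes "ring_unit T"
  shows ring_inv_right: "T * ring_inv T = 1" and ring_inv_left: "ring_inv T * T = 1"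
  using assms ring_inv_eqI unfolding ring_unit_def by metis+

lemma
  fixes T :: "'a::ring_1"
  assumes "ring_unit T"
  shows ring_inv_right_assoc: "T * (ring_inv T * x) = x"
    and ring_inv_left_assoc: "ring_inv T * (T * x) = x"
  by (simp_all add: assms ring_inv_left ring_inv_right flip: mult.assoc)

lemma ring_unit_mult:
  fixes T :: "'a::ring_1"
  assumes "ring_unit T" "ring_unit S"
  shows "ring_unit (T * S)"
proof (rule ring_unitI)
  show "(ring_inv S * ring_inv T) * (T * S) = 1" "(T * S) * (ring_inv S * ring_inv T) = 1"
    by (simp_all add: assms mult.assoc ring_inv_left_assoc ring_inv_right_assoc
        ring_inv_left ring_inv_right)
qed

lemma ring_unit_mult_eq_iff:
  fixes T :: "'a::ring_1"
  assumes "ring_unit T"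
  shows "U * ring_inv T = V \<longleftrightarrow> U = V * T"
  by (metis assms mult.assoc mult.right_neutral ring_inv_left ring_inv_right)

text \<open>Here \<open>1 - x * x\<close> is the product of the commuting factors
  \<open>1 - x\<close> and \<open>1 + x\<close>. Iterating this squaring step replaces the geometric
  series when \<open>x\<close> is nilpotent.\<close>

lemma ring_unit_one_diff_square:
  fixes x :: "'a::ring_1"
  assumes "ring_unit (1 - x * x)"
  shows "ring_unit (1 - x)"
proof -
  obtain S where S: "(1 - x * x) * S = 1" "S * (1 - x * x) = 1"
    using assms unfolding ring_unit_def by blast
  show ?thesis
  proof (rule ring_unitI)
    have "(1 + x) * (1 - x) = 1 - x * x" "(1 - x) * (1 + x) = 1 - x * x"
      by (simp_all add: algebra_simps)
    then show "(S * (1 + x)) * (1 - x) = 1" "(1 - x) * ((1 + x) * S) = 1"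
      by (metis S mult.assoc)+
  qed
qed

text \<open>A central factor can be moved to either side, so a two-sided inverse of the product
  yields inverses on both sides of each factor.\<close>

lemma ring_unit_central_factor:
  fixes z :: "'a::ring_1"
  assumes "z \<in> ring_center" "ring_unit (z * x)"
  shows "ring_unit z" "ring_unit x"
proof -
  let ?S = "ring_inv (z * x)"
  have comm: "z * y = y * z" for y
    using assms(1) by (simp add: ring_center_def)
  have S: "z * x * ?S = 1" "?S * (z * x) = 1"
    using assms(2) by (simp_all add: ring_inv_left ring_inv_right)
  show "ring_unit z"
  proof (rule ring_unitI)
    show "z * (x * ?S) = 1" using S(1) by (simp add: mult.assoc)
    then show "(x * ?S) * z = 1" by (simp add: comm)
  qed
  show "ring_unit x"
  proof (rule ring_unitI)
    show "(?S * z) * x = 1" using S(2) by (simp add: mult.assoc)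
    show "x * (z * ?S) = 1" using S(1) by (metis comm mult.assoc)
  qed
qed

section \<open>Maximal left ideals and membership in the Jacobson radical\<close>

lemma left_ideal_proper_iff:
  fixes I :: "'a::ring_1 set"
  assumes "left_ideal I"
  shows "I \<noteq> UNIV \<longleftrightarrow> 1 \<notin> I"
  using assms unfolding left_ideal_def by (metis UNIV_I UNIV_eq_I mult.right_neutral)

text \<open>Zorn's lemma: properness is expressed as \<open>1\<close> lying outside, a condition
  that survives unions of chains.\<close>

lemma proper_left_ideal_subset_maximal:
  fixes I :: "'a::ring_1 set"
  assumes I: "left_ideal I" "1 \<notin> I"
  obtains M where "maximal_left_ideal M" "I \<subseteq> M"
proof -
  let ?A = "{L. left_ideal L \<and> 1 \<notin> L \<and> I \<subseteq> L}"
  have "\<exists>M\<in>?A. \<forall>X\<in>?A. M \<subseteq> X \<longrightarrow> X = M"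
  proof (rule subset_Zorn_nonempty)
    show "?A \<noteq> {}" using I by blast
    fix C assume "C \<noteq> {}" and chain: "subset.chain ?A C"
    then have sub: "C \<subseteq> ?A" and tot: "\<And>X Y. X \<in> C \<Longrightarrow> Y \<in> C \<Longrightarrow> X \<subseteq> Y \<or> Y \<subseteq> X"
      unfolding subset_chain_def by blast+
    have "left_ideal (\<Union> C)"
      unfolding left_ideal_def
    proof (intro conjI ballI allI)
      show "0 \<in> \<Union> C"
        using \<open>C \<noteq> {}\<close> sub unfolding left_ideal_def by blast
      fix x assume x: "x \<in> \<Union> C"
      then show "a * x \<in> \<Union> C" for a
        using sub unfolding left_ideal_def by blast
      fix y assume "y \<in> \<Union> C"
      then obtain X where "X \<in> C" "x \<in> X" "y \<in> X"
        using x tot by blast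
      then show "x + y \<in> \<Union> C"
        using sub unfolding left_ideal_def by blast
    qed
    moreover have "I \<subseteq> \<Union> C"
      using \<open>C \<noteq> {}\<close> sub by blast
    moreover have "1 \<notin> \<Union> C"
      using sub by blast
    ultimately show "\<Union> C \<in> ?A"
      by simp
  qed
  then obtain M where "M \<in> ?A" and max': "\<forall>X\<in>?A. M \<subseteq> X \<longrightarrow> X = M"
    by (rule bexE)
  then have M: "left_ideal M" "1 \<notin> M" "I \<subseteq> M"
    by simp_all
  have max: "X = M" if "left_ideal X" "1 \<notin> X" "M \<subseteq> X" for X
    using max' that M(3) by simp
  have "maximal_left_ideal M"
    unfolding maximal_left_ideal_def using M max left_ideal_proper_iff by metis
  then show thesis
    using M(3) that by blast
qed

lemma jacobson_radical_left_ideal: "left_ideal (jacobson_radical :: 'a::ring_1 set)"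
proof -
  have *: "left_ideal (\<Inter> S)" if "\<And>M. M \<in> S \<Longrightarrow> left_ideal M" for S :: "'a set set"
    using that unfolding left_ideal_def by (simp add: Ball_def)
  show ?thesis
    unfolding jacobson_radical_def by (rule *) (simp add: maximal_left_ideal_def)
qed

text \<open>Without a left inverse, the left multiples of \<open>1 - x\<close> form a proper left
  ideal. A maximal left ideal above it contains \<open>1 - x\<close> and \<open>x\<close>, hence
  \<open>1\<close>.\<close>

lemma jacobson_radical_left_inverse:
  fixes x :: "'a::ring_1"
  assumes x: "x \<in> jacobson_radical"
  shows "\<exists>s. s * (1 - x) = 1"
proof (rule ccontr)
  assume no_inv: "\<nexists>s. s * (1 - x) = 1"
  let ?I = "range (\<lambda>s. s * (1 - x))"
  have "left_ideal ?I"
    unfolding left_ideal_def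
  proof (intro conjI ballI allI)
    show "0 \<in> ?I" by (auto intro: image_eqI[where x = 0])
    fix u assume "u \<in> ?I"
    then obtain s where s: "u = s * (1 - x)" by blast
    show "a * u \<in> ?I" for a
      unfolding s mult.assoc[symmetric] by blast
    fix v assume "v \<in> ?I"
    then obtain t where t: "v = t * (1 - x)" by blast
    show "u + v \<in> ?I"
      unfolding s t distrib_right[symmetric] by blast
  qed
  moreover have "1 \<notin> ?I"
    using no_inv by (metis imageE)
  ultimately obtain M where M: "maximal_left_ideal M" "?I \<subseteq> M"
    using proper_left_ideal_subset_maximal by blast
  have "x \<in> M"
    using x M(1) unfolding jacobson_radical_def by blast
  moreover have "1 * (1 - x) \<in> M"
    using M(2) by blast
  moreover have M_ideal: "left_ideal M" "M \<noteq> UNIV"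
    using M(1) unfolding maximal_left_ideal_def by blast+
  ultimately have "1 * (1 - x) + x \<in> M"
    unfolding left_ideal_def by blast
  then show False
    using M_ideal left_ideal_proper_iff[OF M_ideal(1)] by simp
qed

lemma one_notin_jacobson_radical: "1 \<notin> (jacobson_radical :: 'a::ring_1 set)"
  using jacobson_radical_left_inverse by fastforce

text \<open>Right multiplication by a unit is an automorphism of the ring as a left module, so it
  permutes the maximal left ideals. This makes their intersection stable under such
  multiplications.\<close>

lemma maximal_left_ideal_mult_unit:
  fixes u :: "'a::ring_1"
  assumes M: "maximal_left_ideal M" and u: "ring_unit u"
  shows "maximal_left_ideal {x. x * u \<in> M}"
proof -
  have ideal: "left_ideal {x. x * v \<in> L}" if "left_ideal L" for L and v :: 'a
    using that unfolding left_ideal_def by (auto simp: distrib_right mult.assoc)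
  have M': "left_ideal M" "M \<noteq> UNIV"
    and max: "\<And>I. left_ideal I \<Longrightarrow> M \<subseteq> I \<Longrightarrow> I \<noteq> UNIV \<Longrightarrow> I = M"
    using M unfolding maximal_left_ideal_def by blast+
  have inv: "x * u * ring_inv u = x" "x * ring_inv u * u = x" for x
    by (simp_all add: mult.assoc ring_inv_left ring_inv_right u)
  show ?thesis
    unfolding maximal_left_ideal_def
  proof (intro conjI allI impI)
    show "left_ideal {x. x * u \<in> M}"
      using M' ideal by blast
    show "{x. x * u \<in> M} \<noteq> UNIV"
      using M' inv by (metis (no_types, lifting) UNIV_I UNIV_eq_I mem_Collect_eq)
    fix I assume I: "left_ideal I \<and> {x. x * u \<in> M} \<subseteq> I \<and> I \<noteq> UNIV"
    have "{x. x * ring_inv u \<in> I} = M"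
    proof (rule max)
      show "left_ideal {x. x * ring_inv u \<in> I}"
        using I ideal by blast
      show "M \<subseteq> {x. x * ring_inv u \<in> I}"
      proof
        fix x assume "x \<in> M"
        then have "x * ring_inv u \<in> {x. x * u \<in> M}"
          using inv by simp
        then show "x \<in> {x. x * ring_inv u \<in> I}"
          using I by blast
      qed
      show "{x. x * ring_inv u \<in> I} \<noteq> UNIV"
        using I inv by (metis (no_types, lifting) UNIV_I UNIV_eq_I mem_Collect_eq)
    qed
    then show "I = {x. x * u \<in> M}"
      using inv by auto
  qed
qed

lemma jacobson_radical_mult_unit:
  fixes u :: "'a::ring_1"
  assumes "x \<in> jacobson_radical" "ring_unit u"
  shows "x * u \<in> jacobson_radical"
  using assms maximal_left_ideal_mult_unit unfolding jacobson_radical_def by blast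

text \<open>Adjoining \<open>x\<close> to a maximal left ideal \<open>M\<close> leaves it proper:
  \<open>1 = m + a * x\<close> would put the unit \<open>1 - a * x\<close> into \<open>M\<close>. By
  maximality \<open>x\<close> was already in \<open>M\<close>.\<close>

lemma jacobson_radicalI:
  fixes x :: "'a::ring_1"
  assumes "\<And>a. ring_unit (1 - a * x)"
  shows "x \<in> jacobson_radical"
  unfolding jacobson_radical_def
proof clarify
  fix M :: "'a set" assume M: "maximal_left_ideal M"
  then have ideal: "left_ideal M" and "M \<noteq> UNIV"
    and max: "\<And>I. left_ideal I \<Longrightarrow> M \<subseteq> I \<Longrightarrow> I \<noteq> UNIV \<Longrightarrow> I = M"
    unfolding maximal_left_ideal_def by blast+
  then have "1 \<notin> M"
    using left_ideal_proper_iff by blast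
  let ?I = "{m + a * x | m a. m \<in> M}"
  have M_in: "m \<in> M \<Longrightarrow> m \<in> ?I" for m
    by (rule CollectI, rule exI[of _ m], rule exI[of _ 0]) simp
  have "left_ideal ?I"
    unfolding left_ideal_def
  proof (intro conjI ballI allI)
    show "0 \<in> ?I"
      using M_in ideal unfolding left_ideal_def by blast
    fix u assume "u \<in> ?I"
    then obtain m a where m: "u = m + a * x" "m \<in> M" by blast
    show "b * u \<in> ?I" for b
      using ideal m unfolding left_ideal_def
      by (intro CollectI exI[of _ "b * m"] exI[of _ "b * a"]) (auto simp: distrib_left mult.assoc)
    fix v assume "v \<in> ?I"
    then obtain k b where k: "v = k + b * x" "k \<in> M" by blast
    show "u + v \<in> ?I"
      using ideal m k unfolding left_ideal_def
      by (intro CollectI exI[of _ "m + k"] exI[of _ "a + b"]) (auto simp: distrib_right)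
  qed
  moreover have "1 \<notin> ?I"
  proof
    assume "1 \<in> ?I"
    then obtain m a where "1 = m + a * x" "m \<in> M" by blast
    then have "1 - a * x \<in> M" by (metis add_diff_cancel_right')
    then have "ring_inv (1 - a * x) * (1 - a * x) \<in> M"
      using ideal unfolding left_ideal_def by blast
    then show False
      using \<open>1 \<notin> M\<close> assms ring_inv_left by metis
  qed
  ultimately have "?I = M"
    using max M_in left_ideal_proper_iff by blast
  moreover have "x \<in> ?I"
    using ideal unfolding left_ideal_def by (intro CollectI exI[of _ 0] exI[of _ 1]) auto
  ultimately show "x \<in> M" by blast
qed

section \<open>The monomial basis of a geometric algebra\<close>

context geometric_algebra
begin

abbreviation idx :: "nat set" where
  "idx \<equiv> {1..n}"

text \<open>Described through the metric instead of \<open>p\<close>, \<open>q\<close>,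
  \<open>r\<close>, so that the real and the complex case share one development.\<close>

definition null_idx :: "nat set" where
  "null_idx = {a \<in> idx. \<eta> a = 0}"

lemma finite_subset_idx: "A \<subseteq> idx \<Longrightarrow> finite A"
  using finite_subset by blast

lemma basis_elt_empty [simp]: "basis_elt {} = 1"
  by (simp add: basis_elt_def)

lemma basis_elt_insert_min:
  assumes "finite A" "\<forall>x\<in>A. b < x"
  shows "basis_elt (insert b A) = e b * basis_elt A"
proof -
  have "Min (insert b A) = b"
    using assms by (intro Min_eqI) auto
  moreover have "insert b A - {b} = A"
    using assms by auto
  ultimately show ?thesis
    using sorted_list_of_set_nonempty[of "insert b A"] assms by (simp add: basis_elt_def)
qed

lemma basis_elt_singleton [simp]: "basis_elt {a} = e a"
  by (simp add: basis_elt_def)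

section \<open>Products of generators and monomials\<close>

lemma e_square: "2 \<noteq> (0::'f) \<Longrightarrow> a \<in> idx \<Longrightarrow> e a * e a = \<eta> a *s 1"
proof -
  assume "2 \<noteq> (0::'f)" "a \<in> idx"
  then have "(2::'f) *s (e a * e a) = (2 * \<eta> a) *s 1"
    using relations[of a a] scale_left_distrib[of 1 1 "e a * e a"] by simp
  then have "(2::'f) *s (e a * e a) = 2 *s (\<eta> a *s 1)"
    by simp
  then show ?thesis
    using \<open>2 \<noteq> 0\<close> scale_left_imp_eq by blast
qed

lemma e_anticommute: "a \<in> idx \<Longrightarrow> b \<in> idx \<Longrightarrow> a \<noteq> b \<Longrightarrow> e a * e b = - (e b * e a)"
  using relations[of a b] by (simp add: eq_neg_iff_add_eq_0)

text \<open>Every factor except \<open>e a\<close> itself contributes one sign when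
  \<open>e a\<close> is moved from the right end to the left end.\<close>

lemma basis_elt_mult_e:
  assumes "A \<subseteq> idx" "a \<in> idx"
  shows "basis_elt A * e a = ((-1) ^ card (A - {a})) *s (e a * basis_elt A)"
  using finite_subset_idx[OF assms(1)] assms(1)
proof (induction A rule: finite_linorder_min_induct)
  case empty
  then show ?case by simp
next
  case (insert b A)
  then have b: "b \<notin> A" "b \<in> idx" and IH: "basis_elt A * e a = ((-1) ^ card (A - {a})) *s (e a * basis_elt A)"
    by auto
  have "basis_elt (insert b A) * e a = e b * (basis_elt A * e a)"
    using insert by (simp add: basis_elt_insert_min mult.assoc)
  also have "\<dots> = ((-1) ^ card (A - {a})) *s (e b * e a * basis_elt A)"
    unfolding IH by (simp add: scale_mult_right mult.assoc)
  finally have *: "basis_elt (insert b A) * e a = ((-1) ^ card (A - {a})) *s (e b * e a * basis_elt A)" .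
  show ?case
  proof (cases "a = b")
    case True
    then show ?thesis
      using * insert by (simp add: basis_elt_insert_min mult.assoc)
  next
    case False
    then have "card (insert b A - {a}) = Suc (card (A - {a}))"
      using b insert by (simp add: insert_Diff_if)
    moreover have "e b * e a = - (e a * e b)"
      using False e_anticommute[OF b(2) assms(2)] by simp
    ultimately show ?thesis
      using * insert by (simp add: basis_elt_insert_min mult.assoc)
  qed
qed

end

locale geometric_algebra_char_not_2 = geometric_algebra scale e \<eta> n
  for scale :: "'f::field \<Rightarrow> 'a::ring_1 \<Rightarrow> 'a" (infixr \<open>*s\<close> 75) and e \<eta> n +
  assumes two_neq_zero: "(2::'f) \<noteq> 0" and dim_pos: "n \<ge> 1"
begin

text \<open>Compare \<open>a\<close> with the least index \<open>b\<close>: a smaller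
  \<open>a\<close> is simply prepended, an equal one produces the square \<open>\<eta> a\<close>,
  and a larger one anticommutes past \<open>e b\<close>. Repeated indices cancel, hence the
  symmetric difference.\<close>

lemma e_mult_basis_elt:
  assumes "A \<subseteq> idx" "a \<in> idx"
  shows "\<exists>c. e a * basis_elt A = c *s basis_elt (sym_diff {a} A) \<and> (c = 0 \<longleftrightarrow> a \<in> A \<and> \<eta> a = 0)"
  using finite_subset_idx[OF assms(1)] assms(1)
proof (induction A rule: finite_linorder_min_induct)
  case empty
  then show ?case
    by (intro exI[of _ 1]) (simp add: basis_elt_def)
next
  case (insert b A)
  then have b: "b \<notin> A" "b \<in> idx" and A: "A \<subseteq> idx" "finite A" "\<forall>x\<in>A. b < x"
    by auto
  obtain c where c: "e a * basis_elt A = c *s basis_elt (sym_diff {a} A)"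
    "c = 0 \<longleftrightarrow> a \<in> A \<and> \<eta> a = 0"
    using insert by auto
  consider "a < b" | "a = b" | "b < a" by linarith
  then show ?case
  proof cases
    case 1
    then have "sym_diff {a} (insert b A) = insert a (insert b A)"
      using A by auto
    moreover have "basis_elt (insert a (insert b A)) = e a * basis_elt (insert b A)"
      using A 1 by (intro basis_elt_insert_min) auto
    ultimately show ?thesis
      using A 1 by (intro exI[of _ 1]) auto
  next
    case 2
    then have "sym_diff {a} (insert b A) = A"
      using b by auto
    then show ?thesis
      using A 2 e_square[OF two_neq_zero assms(2)]
      by (intro exI[of _ "\<eta> a"]) (simp add: basis_elt_insert_min scale_mult_left flip: mult.assoc)
  next
    case 3
    then have eq: "sym_diff {a} (insert b A) = insert b (sym_diff {a} A)"
      using b by auto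
    have "basis_elt (insert b (sym_diff {a} A)) = e b * basis_elt (sym_diff {a} A)"
      using A 3 by (intro basis_elt_insert_min) auto
    moreover have "e a * basis_elt (insert b A) = - (e b * (e a * basis_elt A))"
      using A b 3 e_anticommute[OF assms(2) b(2)] by (simp add: basis_elt_insert_min flip: mult.assoc)
    ultimately show ?thesis
      unfolding eq c(1) using c(2) 3 by (intro exI[of _ "- c"]) (simp add: scale_mult_right)
  qed
qed

text \<open>The constant is a sign times the product of the metric values on
  \<open>A \<inter> B\<close>, so it vanishes exactly when a null generator gets squared.\<close>

lemma basis_elt_mult:
  assumes "A \<subseteq> idx" "B \<subseteq> idx"
  shows "\<exists>c. basis_elt A * basis_elt B = c *s basis_elt (sym_diff A B) \<and>
    (c = 0 \<longleftrightarrow> A \<inter> B \<inter> null_idx \<noteq> {})"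
  using finite_subset_idx[OF assms(1)] assms(1)
proof (induction A rule: finite_linorder_min_induct)
  case empty
  then show ?case by (intro exI[of _ 1]) simp
next
  case (insert b A)
  then have b: "b \<notin> A" "b \<in> idx" and A: "A \<subseteq> idx" "finite A" "\<forall>x\<in>A. b < x"
    by auto
  obtain c where c: "basis_elt A * basis_elt B = c *s basis_elt (sym_diff A B)"
    "c = 0 \<longleftrightarrow> A \<inter> B \<inter> null_idx \<noteq> {}"
    using insert by auto
  have "sym_diff A B \<subseteq> idx"
    using A assms by blast
  then obtain d where d: "e b * basis_elt (sym_diff A B) = d *s basis_elt (sym_diff {b} (sym_diff A B))"
    "d = 0 \<longleftrightarrow> b \<in> sym_diff A B \<and> \<eta> b = 0"
    using e_mult_basis_elt b(2) by blast
  have "sym_diff {b} (sym_diff A B) = sym_diff (insert b A) B"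
    using b(1) by blast
  then have "basis_elt (insert b A) * basis_elt B = (c * d) *s basis_elt (sym_diff (insert b A) B)"
    using A c(1) d(1) by (simp add: basis_elt_insert_min mult.assoc scale_mult_right)
  moreover have "c * d = 0 \<longleftrightarrow> insert b A \<inter> B \<inter> null_idx \<noteq> {}"
    using c(2) d(2) b by (auto simp: null_idx_def)
  ultimately show ?case by blast
qed

lemma e_mult_basis_elt_mult_e:
  assumes "A \<subseteq> idx" "a \<in> idx"
  shows "e a * basis_elt A * e a = ((-1) ^ card (A - {a}) * \<eta> a) *s basis_elt A"
  using e_square[OF two_neq_zero assms(2)] basis_elt_mult_e[OF assms]
  by (simp add: mult.assoc scale_mult_right) (simp add: scale_mult_left flip: mult.assoc)

section \<open>Linear independence of the monomials and coordinates\<close>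

definition monomials :: "'a set" where
  "monomials = basis_elt ` Pow idx"

text \<open>The span contains \<open>1\<close> and the generators and is closed under products,
  because a product of two monomials is a multiple of a monomial.\<close>

lemma span_monomials: "span monomials = UNIV"
proof (rule generators)
  show "subspace (span monomials)" by (rule subspace_span)
  have "basis_elt {} \<in> span monomials"
    unfolding monomials_def by (intro span_base imageI) auto
  then show "1 \<in> span monomials" by simp
  have "basis_elt {a} \<in> span monomials" if "a \<in> idx" for a
    unfolding monomials_def using that by (intro span_base imageI) auto
  then show "a \<in> idx \<Longrightarrow> e a \<in> span monomials" for a by simp
  fix x y assume x: "x \<in> span monomials" and y: "y \<in> span monomials"
  have *: "basis_elt A * basis_elt B \<in> span monomials" if AB: "A \<subseteq> idx" "B \<subseteq> idx" for A B
  proof -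
    obtain c where "basis_elt A * basis_elt B = c *s basis_elt (sym_diff A B)"
      using basis_elt_mult[OF AB] by blast
    moreover have "basis_elt (sym_diff A B) \<in> span monomials"
      unfolding monomials_def using AB by (intro span_base imageI) auto
    ultimately show ?thesis
      by (simp add: span_scale)
  qed
  have **: "basis_elt A * y \<in> span monomials" if "A \<subseteq> idx" for A
    using y
  proof (induction rule: span_induct_alt)
    case base
    then show ?case by (simp add: span_zero)
  next
    case (step c u v)
    then show ?case
      using that * by (auto simp: monomials_def distrib_left scale_mult_right intro!: span_add span_scale)
  qed
  show "x * y \<in> span monomials"
    using x
  proof (induction rule: span_induct_alt)
    case base
    then show ?case by (simp add: span_zero)
  next
    case (step c u v)
    then show ?case
      using ** by (auto simp: monomials_def distrib_right scale_mult_left intro!: span_add span_scale)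
  qed
qed

text \<open>Counting: a basis chosen among the monomials has \<open>2 ^ n\<close> elements, while
  there are at most \<open>2 ^ n\<close> monomials. Hence none is discarded and no two
  coincide.\<close>

lemma
  shows independent_monomials: "independent monomials"
    and inj_basis_elt: "inj_on basis_elt (Pow idx)"
proof -
  obtain B where B: "B \<subseteq> monomials" "independent B" "monomials \<subseteq> span B"
    using maximal_independent_subset by blast
  have "span B = UNIV"
    using B(3) span_monomials span_minimal[OF _ subspace_span] by blast
  then have "card B = 2 ^ n"
    using dim_algebra dim_eq_card[of B UNIV] B(2) by simp
  moreover have fin: "finite monomials"
    by (simp add: monomials_def)
  moreover have "card monomials \<le> card (Pow idx)"
    unfolding monomials_def by (rule card_image_le) simp
  moreover have "card B \<le> card monomials"
    using B(1) fin card_mono by blast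
  moreover have "card (Pow idx) = 2 ^ n"
    by (simp add: card_Pow)
  ultimately have "B = monomials" "card monomials = card (Pow idx)"
    using B(1) card_subset_eq[of monomials B] by auto
  then show "independent monomials" "inj_on basis_elt (Pow idx)"
    using B(2) unfolding monomials_def by (auto intro: eq_card_imp_inj_on)
qed

text \<open>To be read for \<open>A \<subseteq> idx\<close>, where distinct index sets give distinct
  monomials.\<close>

definition coef :: "nat set \<Rightarrow> 'a \<Rightarrow> 'f" where
  "coef A x = representation monomials x (basis_elt A)"

lemma
  shows coef_zero [simp]: "coef A 0 = 0"
    and coef_add [simp]: "coef A (x + y) = coef A x + coef A y"
    and coef_diff [simp]: "coef A (x - y) = coef A x - coef A y"
    and coef_uminus [simp]: "coef A (- x) = - coef A x"
    and coef_scale [simp]: "coef A (c *s x) = c * coef A x"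
  unfolding coef_def
  by (simp_all add: representation_zero representation_add representation_diff representation_neg
      representation_scale independent_monomials span_monomials)

lemma coef_sum [simp]: "coef A (sum f I) = (\<Sum>i\<in>I. coef A (f i))"
  by (induction I rule: infinite_finite_induct) auto

lemma coef_basis_elt:
  "A \<subseteq> idx \<Longrightarrow> B \<subseteq> idx \<Longrightarrow> coef A (basis_elt B) = (if A = B then 1 else 0)"
  unfolding coef_def using inj_basis_elt
  by (subst representation_basis[OF independent_monomials]) (auto simp: monomials_def inj_on_def)

lemma sum_coef: "(\<Sum>A\<in>Pow idx. coef A x *s basis_elt A) = x"
proof -
  have "(\<Sum>b\<in>monomials. representation monomials x b *s b) = x"
    by (rule sum_representation_eq) (simp_all add: independent_monomials span_monomials, simp add: monomials_def)
  moreover have "(\<Sum>b\<in>monomials. f b) = (\<Sum>A\<in>Pow idx. f (basis_elt A))" for f :: "'a \<Rightarrow> 'a"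
    unfolding monomials_def by (rule sum.reindex[OF inj_basis_elt, unfolded o_def])
  ultimately show ?thesis
    by (simp add: coef_def)
qed

lemma coef_eqI: "(\<And>A. A \<subseteq> idx \<Longrightarrow> coef A x = coef A y) \<Longrightarrow> x = y"
  using sum_coef[of x] sum_coef[of y] by (metis (no_types, lifting) PowD sum.cong)

text \<open>Zero has no case of its own: it is the monomial \<open>1\<close> scaled by
  \<open>0\<close>.\<close>

lemma basis_elt_induct [case_names add scale basis]:
  assumes "\<And>x y. Q x \<Longrightarrow> Q y \<Longrightarrow> Q (x + y)" "\<And>c x. Q x \<Longrightarrow> Q (c *s x)"
    and "\<And>A. A \<subseteq> idx \<Longrightarrow> Q (basis_elt A)"
  shows "Q x"
proof -
  have "x \<in> span monomials" by (simp add: span_monomials)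
  then show ?thesis
  proof (induction rule: span_induct_alt)
    case base
    show ?case using assms(2)[OF assms(3)[of "{}"], of 0] by simp
  next
    case (step c u v)
    then show ?case using assms by (auto simp: monomials_def)
  qed
qed

text \<open>For fixed \<open>B\<close> the map sending \<open>A\<close> to
  \<open>sym_diff A B\<close> is injective, so exactly one monomial of \<open>x\<close> can
  contribute to the given coordinate.\<close>

lemma coef_mult_basis_elt:
  assumes "A \<subseteq> idx" "B \<subseteq> idx"
  shows "coef (sym_diff A B) (x * basis_elt B) =
    coef A x * coef (sym_diff A B) (basis_elt A * basis_elt B)"
proof (induction x rule: basis_elt_induct)
  case (basis C)
  obtain c where c: "basis_elt C * basis_elt B = c *s basis_elt (sym_diff C B)"
    using basis_elt_mult[OF basis assms(2)] by blast
  have "A \<noteq> C \<Longrightarrow> sym_diff A B \<noteq> sym_diff C B" "sym_diff A B \<subseteq> idx" "sym_diff C B \<subseteq> idx"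
    using assms basis by blast+
  then show ?case
    using assms basis c by (auto simp: coef_basis_elt)
qed (simp_all add: distrib_right scale_mult_left)

lemma coef_basis_elt_mult:
  assumes "A \<subseteq> idx" "B \<subseteq> idx"
  shows "coef (sym_diff B A) (basis_elt B * x) =
    coef A x * coef (sym_diff B A) (basis_elt B * basis_elt A)"
proof (induction x rule: basis_elt_induct)
  case (basis C)
  obtain c where c: "basis_elt B * basis_elt C = c *s basis_elt (sym_diff B C)"
    using basis_elt_mult[OF assms(2) basis] by blast
  have "A \<noteq> C \<Longrightarrow> sym_diff B A \<noteq> sym_diff B C" "sym_diff B A \<subseteq> idx" "sym_diff B C \<subseteq> idx"
    using assms basis by blast+
  then show ?case
    using assms basis c by (auto simp: coef_basis_elt)
qed (simp_all add: distrib_left distrib_right scale_mult_right)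

lemma coef_basis_elt_mult_basis_elt_eq_0_iff:
  assumes "A \<subseteq> idx" "B \<subseteq> idx"
  shows "coef (sym_diff A B) (basis_elt A * basis_elt B) = 0 \<longleftrightarrow> A \<inter> B \<inter> null_idx \<noteq> {}"
proof -
  have "sym_diff A B \<subseteq> idx" using assms by blast
  then show ?thesis
    using basis_elt_mult[OF assms] by (auto simp: coef_basis_elt)
qed

section \<open>Grade involution and parity\<close>

text \<open>Passing to the symmetric difference removes the intersection twice, which keeps the
  parity. This is what makes the grade involution multiplicative.\<close>

lemma minus_one_power_card_sym_diff:
  assumes "A \<subseteq> idx" "B \<subseteq> idx"
  shows "(- 1) ^ card (sym_diff A B) = (- 1 :: 'f) ^ card A * (- 1) ^ card B"
proof -
  have fin: "finite A" "finite B"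
    using assms finite_subset_idx by blast+
  have "card A = card (A - B) + card (A \<inter> B)" "card B = card (B - A) + card (A \<inter> B)"
    using fin card_Int_Diff[of A B] card_Int_Diff[of B A] by (simp_all add: Int_commute)
  moreover have "card (sym_diff A B) = card (A - B) + card (B - A)"
    using fin by (intro card_Un_disjoint) auto
  ultimately show ?thesis
    by (simp add: power_add)
qed

text \<open>Existence: the diagonal map with sign \<open>(- 1) ^ card A\<close> on the monomial of
  \<open>A\<close> has all required properties. Uniqueness: two candidates agree on a subalgebra
  containing the generators. The second fact lets the coordinate formula be transferred to
  \<open>hat\<close>.\<close>

lemma hat_ex1:
  "\<exists>!f. Vector_Spaces.linear scale scale f \<and> bij f \<and> f 1 = 1 \<and>
     (\<forall>x y. f (x * y) = f x * f y) \<and> (\<forall>a\<in>{1..n}. f (e a) = - e a)"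
  and coef_hat_ex: "\<exists>f. (Vector_Spaces.linear scale scale f \<and> bij f \<and> f 1 = 1 \<and>
     (\<forall>x y. f (x * y) = f x * f y) \<and> (\<forall>a\<in>{1..n}. f (e a) = - e a)) \<and>
     (\<forall>A x. A \<subseteq> idx \<longrightarrow> coef A (f x) = (- 1) ^ card A * coef A x)"
proof -
  define f where "f x = (\<Sum>A\<in>Pow idx. ((- 1) ^ card A * coef A x) *s basis_elt A)" for x
  have coef_f: "coef A (f x) = (- 1) ^ card A * coef A x" if "A \<subseteq> idx" for A x
  proof -
    have "coef A (f x) = (\<Sum>B\<in>Pow idx. if B = A then (- 1) ^ card A * coef A x else 0)"
      unfolding f_def coef_sum using that by (intro sum.cong) (auto simp: coef_basis_elt)
    then show ?thesis
      using that by (simp add: sum.delta)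
  qed
  have f_basis: "f (basis_elt A) = (- 1) ^ card A *s basis_elt A" if "A \<subseteq> idx" for A
    using that by (intro coef_eqI) (auto simp: coef_f coef_basis_elt)
  have add: "f (x + y) = f x + f y" for x y
    by (intro coef_eqI) (simp add: coef_f distrib_left)
  have scale: "f (c *s x) = c *s f x" for c x
    by (intro coef_eqI) (simp add: coef_f)
  have ff: "f (f x) = x" for x
    by (intro coef_eqI) (simp add: coef_f flip: mult.assoc power_add)
  have mult: "f (x * y) = f x * f y" for x y
  proof (induction x rule: basis_elt_induct)
    case (basis A)
    show ?case
    proof (induction y rule: basis_elt_induct)
      case (basis B)
      obtain c where "basis_elt A * basis_elt B = c *s basis_elt (sym_diff A B)"
        using basis_elt_mult[OF \<open>A \<subseteq> idx\<close> \<open>B \<subseteq> idx\<close>] by blast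
      moreover have "sym_diff A B \<subseteq> idx"
        using \<open>A \<subseteq> idx\<close> \<open>B \<subseteq> idx\<close> by blast
      ultimately show ?case
        using \<open>A \<subseteq> idx\<close> \<open>B \<subseteq> idx\<close>
        by (simp add: f_basis scale scale_mult_left scale_mult_right minus_one_power_card_sym_diff mult_ac)
    qed (simp_all add: add scale distrib_left scale_mult_right)
  qed (simp_all add: add scale distrib_right scale_mult_left)
  have f1: "f 1 = 1"
    using f_basis[of "{}"] by simp
  have fe: "f (e a) = - e a" if "a \<in> idx" for a
    using f_basis[of "{a}"] that by simp
  have lin: "Vector_Spaces.linear scale scale f"
    by unfold_locales (simp_all add: add scale)
  have "bij f"
    by (rule o_bij[of f]) (simp_all add: ff fun_eq_iff)
  then have f: "Vector_Spaces.linear scale scale f \<and> bij f \<and> f 1 = 1 \<and>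
     (\<forall>x y. f (x * y) = f x * f y) \<and> (\<forall>a\<in>{1..n}. f (e a) = - e a)"
    using lin f1 mult fe by blast
  then show "\<exists>f. (Vector_Spaces.linear scale scale f \<and> bij f \<and> f 1 = 1 \<and>
     (\<forall>x y. f (x * y) = f x * f y) \<and> (\<forall>a\<in>{1..n}. f (e a) = - e a)) \<and>
     (\<forall>A x. A \<subseteq> idx \<longrightarrow> coef A (f x) = (- 1) ^ card A * coef A x)"
    using coef_f by blast
  show "\<exists>!f. Vector_Spaces.linear scale scale f \<and> bij f \<and> f 1 = 1 \<and>
     (\<forall>x y. f (x * y) = f x * f y) \<and> (\<forall>a\<in>{1..n}. f (e a) = - e a)"
  proof (rule ex1I[of _ f], rule f)
    fix g
    assume g: "Vector_Spaces.linear scale scale g \<and> bij g \<and> g 1 = 1 \<and>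
     (\<forall>x y. g (x * y) = g x * g y) \<and> (\<forall>a\<in>{1..n}. g (e a) = - e a)"
    then interpret g: Vector_Spaces.linear scale scale g by blast
    have "{x. g x = f x} = UNIV"
      using g by (intro generators subspaceI)
        (simp_all add: g.add g.scale g.zero add scale mult f1 fe scale[of 0, simplified])
    then show "g = f" by blast
  qed
qed

lemma
  shows hat_linear: "Vector_Spaces.linear scale scale hat"
    and hat_mult [simp]: "hat (x * y) = hat x * hat y"
    and hat_one [simp]: "hat 1 = 1"
    and coef_hat: "A \<subseteq> idx \<Longrightarrow> coef A (hat x) = (- 1) ^ card A * coef A x"
proof -
  note hat = theI'[OF hat_ex1, folded hat_def]
  then show "Vector_Spaces.linear scale scale hat" "hat (x * y) = hat x * hat y" "hat 1 = 1"
    by blast+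
  show "A \<subseteq> idx \<Longrightarrow> coef A (hat x) = (- 1) ^ card A * coef A x"
    using coef_hat_ex hat_ex1 hat by metis
qed

lemma
  shows hat_zero [simp]: "hat 0 = 0"
    and hat_add [simp]: "hat (x + y) = hat x + hat y"
    and hat_diff [simp]: "hat (x - y) = hat x - hat y"
    and hat_uminus [simp]: "hat (- x) = - hat x"
    and hat_scale [simp]: "hat (c *s x) = c *s hat x"
proof -
  interpret hat: Vector_Spaces.linear scale scale hat by (rule hat_linear)
  show "hat 0 = 0" "hat (x + y) = hat x + hat y" "hat (x - y) = hat x - hat y"
    "hat (- x) = - hat x" "hat (c *s x) = c *s hat x"
    by (simp_all add: hat.zero hat.add hat.diff hat.neg hat.scale)
qed

lemma hat_hat [simp]: "hat (hat x) = x"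
  by (intro coef_eqI) (simp add: coef_hat flip: mult.assoc power_add)

lemma hat_basis_elt: "A \<subseteq> idx \<Longrightarrow> hat (basis_elt A) = (- 1) ^ card A *s basis_elt A"
  by (intro coef_eqI) (auto simp: coef_hat coef_basis_elt)

lemma ring_unit_hat:
  assumes "ring_unit T"
  shows "ring_unit (hat T)"
proof (rule ring_unitI)
  show "hat (ring_inv T) * hat T = 1" "hat T * hat (ring_inv T) = 1"
    using assms by (simp_all add: ring_inv_left ring_inv_right flip: hat_mult)
qed

section \<open>Even and odd parts\<close>

lemma parity_subspace_0_iff: "U \<in> parity_subspace 0 \<longleftrightarrow> hat U = U"
  and parity_subspace_1_iff: "U \<in> parity_subspace 1 \<longleftrightarrow> hat U = - U"
  by (simp_all add: parity_subspace_def)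

lemma half_double: "(1 / 2) *s (x + x) = x"
proof -
  have "x + x = (2::'f) *s x"
    using scale_left_distrib[of 1 1 x] by simp
  then show ?thesis
    using two_neq_zero by simp
qed

lemma diff_half_add: "U - (1 / 2) *s (U + V) = (1 / 2) *s (U - V)"
proof -
  have "U - (1 / 2) *s (U + V) = (1 / 2) *s (U + U) - (1 / 2) *s (U + V)"
    by (simp only: half_double)
  then show ?thesis
    by (simp flip: scale_right_diff_distrib)
qed

lemma even_part_eq: "even_part U = (1 / 2) *s (U + hat U)"
  unfolding even_part_def
proof (rule the_equality)
  have "U - (1 / 2) *s (U + hat U) = (1 / 2) *s (U - hat U)"
    by (rule diff_half_add)
  then show "(1 / 2) *s (U + hat U) \<in> parity_subspace 0 \<and>
      U - (1 / 2) *s (U + hat U) \<in> parity_subspace 1"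
    unfolding parity_subspace_0_iff parity_subspace_1_iff
    by (simp add: add.commute flip: scale_minus_right)
next
  fix V assume "V \<in> parity_subspace 0 \<and> U - V \<in> parity_subspace 1"
  then have "hat V = V" "hat (U - V) = - (U - V)"
    unfolding parity_subspace_0_iff parity_subspace_1_iff by blast+
  then have "hat U = V + V - U"
    by (simp add: algebra_simps)
  then show "V = (1 / 2) *s (U + hat U)"
    by (simp add: half_double)
qed

lemma odd_part_eq: "odd_part U = (1 / 2) *s (U - hat U)"
  by (simp add: odd_part_def even_part_eq diff_half_add)

lemma
  shows even_part_add: "even_part (U + V) = even_part U + even_part V"
    and odd_part_add: "odd_part (U + V) = odd_part U + odd_part V"
    and even_part_scale: "even_part (c *s U) = c *s even_part U"
    and odd_part_scale: "odd_part (c *s U) = c *s odd_part U"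
  by (simp_all add: even_part_eq odd_part_eq algebra_simps scale_right_distrib
      scale_right_diff_distrib)

lemma even_plus_odd_part: "even_part U + odd_part U = U"
  by (simp add: odd_part_def)

lemma hat_even_part [simp]: "hat (even_part U) = even_part U"
  and hat_odd_part [simp]: "hat (odd_part U) = - odd_part U"
  by (simp_all add: even_part_eq odd_part_eq add.commute flip: scale_minus_right)

lemma even_part_of_even: "hat U = U \<Longrightarrow> even_part U = U"
  and odd_part_of_even: "hat U = U \<Longrightarrow> odd_part U = 0"
  and even_part_of_odd: "hat U = - U \<Longrightarrow> even_part U = 0"
  and odd_part_of_odd: "hat U = - U \<Longrightarrow> odd_part U = U"
  by (simp_all add: even_part_eq odd_part_eq half_double)

lemma P_pm_iff: "T \<in> P_pm \<longleftrightarrow> ring_unit T \<and> (hat T = T \<or> hat T = - T)"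
  by (auto simp: P_pm_def units_in_def parity_subspace_0_iff
      parity_subspace_1_iff[unfolded One_nat_def])

section \<open>The ideal generated by the null generators\<close>

text \<open>This is the \<open>k\<close>-th power of the ideal generated by the null generators:
  every monomial that occurs has at least \<open>k\<close> null factors.\<close>

definition null_power :: "nat \<Rightarrow> 'a set" where
  "null_power k = {x. \<forall>A\<subseteq>idx. card (A \<inter> null_idx) < k \<longrightarrow> coef A x = 0}"

lemma null_power_0 [simp]: "null_power 0 = UNIV"
  by (simp add: null_power_def)

lemma
  shows null_power_zero: "0 \<in> null_power k"
    and null_power_add: "x \<in> null_power k \<Longrightarrow> y \<in> null_power k \<Longrightarrow> x + y \<in> null_power k"
    and null_power_diff: "x \<in> null_power k \<Longrightarrow> y \<in> null_power k \<Longrightarrow> x - y \<in> null_power k"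
    and null_power_uminus: "x \<in> null_power k \<Longrightarrow> - x \<in> null_power k"
    and null_power_scale: "x \<in> null_power k \<Longrightarrow> c *s x \<in> null_power k"
    and null_power_hat: "x \<in> null_power k \<Longrightarrow> hat x \<in> null_power k"
  by (simp_all add: null_power_def coef_hat)

lemma null_power_scale_iff: "c \<noteq> 0 \<Longrightarrow> c *s x \<in> null_power k \<longleftrightarrow> x \<in> null_power k"
  by (simp add: null_power_def)

lemma null_power_sum: "(\<And>i. i \<in> I \<Longrightarrow> f i \<in> null_power k) \<Longrightarrow> sum f I \<in> null_power k"
  by (induction I rule: infinite_finite_induct) (simp_all add: null_power_zero null_power_add)

lemma basis_elt_in_null_power:
  "A \<subseteq> idx \<Longrightarrow> k \<le> card (A \<inter> null_idx) \<Longrightarrow> basis_elt A \<in> null_power k"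
  by (auto simp: null_power_def coef_basis_elt)

text \<open>When a product of two monomials is nonzero they share no null index, so their numbers of
  null factors add up.\<close>

lemma null_power_mult:
  assumes "x \<in> null_power i" "y \<in> null_power j"
  shows "x * y \<in> null_power (i + j)"
proof -
  have summand: "coef A x *s basis_elt A * coef B y *s basis_elt B \<in> null_power (i + j)"
    if AB: "A \<subseteq> idx" "B \<subseteq> idx" for A B
  proof (cases "coef A x = 0 \<or> coef B y = 0")
    case True
    then show ?thesis by (auto simp: null_power_zero)
  next
    case False
    then have "\<not> card (A \<inter> null_idx) < i" "\<not> card (B \<inter> null_idx) < j"
      using assms AB by (auto simp: null_power_def)
    then have le: "i \<le> card (A \<inter> null_idx)" "j \<le> card (B \<inter> null_idx)"
      by simp_all
    obtain c where c: "basis_elt A * basis_elt B = c *s basis_elt (sym_diff A B)"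
      "c = 0 \<longleftrightarrow> A \<inter> B \<inter> null_idx \<noteq> {}"
      using basis_elt_mult[OF AB] by blast
    have "c *s basis_elt (sym_diff A B) \<in> null_power (i + j)"
    proof (cases "c = 0")
      case True
      then show ?thesis by (simp add: null_power_zero)
    next
      case False
      then have "sym_diff A B \<inter> null_idx = (A \<inter> null_idx) \<union> (B \<inter> null_idx)"
        "(A \<inter> null_idx) \<inter> (B \<inter> null_idx) = {}"
        using c(2) by blast+
      then have "card (sym_diff A B \<inter> null_idx) = card (A \<inter> null_idx) + card (B \<inter> null_idx)"
        using AB finite_subset_idx by (simp add: card_Un_disjoint)
      then show ?thesis
        using AB le by (intro null_power_scale basis_elt_in_null_power) auto
    qed
    from null_power_scale[OF this, of "coef A x * coef B y"] show ?thesis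
      by (simp add: scale_mult_left scale_mult_right c(1) mult_ac)
  qed
  have "x * y = (\<Sum>A\<in>Pow idx. coef A x *s basis_elt A) * (\<Sum>B\<in>Pow idx. coef B y *s basis_elt B)"
    by (simp only: sum_coef)
  also have "\<dots> \<in> null_power (i + j)"
    unfolding sum_product using summand by (intro null_power_sum) blast
  finally show ?thesis .
qed

text \<open>Nilpotency: a monomial has at most \<open>card null_idx\<close> null factors.\<close>

lemma null_power_Suc_card: "null_power (Suc (card null_idx)) = {0}"
proof -
  have "card (A \<inter> null_idx) \<le> card null_idx" for A
    by (intro card_mono) (auto simp: null_idx_def)
  then show ?thesis
    by (auto simp: null_power_def less_Suc_eq_le intro: coef_eqI)
qed

text \<open>Squaring moves \<open>x\<close> into a strictly higher power of the ideal, and beyond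
  \<open>card null_idx\<close> only zero is left. The exponent \<open>Suc k\<close> excludes the
  zeroth power, which is the whole algebra.\<close>

lemma ring_unit_one_diff_null_power:
  "x \<in> null_power (Suc k) \<Longrightarrow> ring_unit (1 - x)"
proof (induction "card null_idx - k" arbitrary: k x rule: less_induct)
  case less
  show ?case
  proof (cases "card null_idx \<le> k")
    case True
    then have "null_power (Suc k) \<subseteq> null_power (Suc (card null_idx))"
      by (auto simp: null_power_def)
    then have "x = 0"
      using less.prems null_power_Suc_card by blast
    then show ?thesis
      using ring_unitI[of 1 1 1] by simp
  next
    case False
    have "x * x \<in> null_power (Suc k + Suc k)"
      using less.prems null_power_mult by blast
    then have "x * x \<in> null_power (Suc (Suc k))"
      by (simp add: null_power_def)
    then have "ring_unit (1 - x * x)"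
      using False by (intro less.hyps[of "Suc k"]) auto
    then show ?thesis
      by (rule ring_unit_one_diff_square)
  qed
qed

section \<open>The null ideal and its equality with the Jacobson radical\<close>

abbreviation null_ideal :: "'a set" where
  "null_ideal \<equiv> null_power (Suc 0)"

lemma null_ideal_iff: "x \<in> null_ideal \<longleftrightarrow> (\<forall>A\<subseteq>idx. A \<inter> null_idx = {} \<longrightarrow> coef A x = 0)"
  by (auto simp: null_power_def finite_subset_idx)

lemma null_ideal_mult_left: "x \<in> null_ideal \<Longrightarrow> y * x \<in> null_ideal"
  using null_power_mult[of y 0 x "Suc 0"] by simp

lemma ring_unit_diff_null_ideal:
  assumes "ring_unit u" "x \<in> null_ideal"
  shows "ring_unit (u - x)"
proof -
  have "ring_unit (u * (1 - ring_inv u * x))"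
    using assms ring_unit_mult ring_unit_one_diff_null_power null_ideal_mult_left by blast
  then show ?thesis
    by (simp add: right_diff_distrib ring_inv_right_assoc assms)
qed

lemma coef_one: "A \<subseteq> idx \<Longrightarrow> coef A 1 = (if A = {} then 1 else 0)"
  using coef_basis_elt[of A "{}"] by simp

lemma ring_unit_notin_null_ideal:
  assumes "ring_unit u"
  shows "u \<notin> null_ideal"
proof
  assume "u \<in> null_ideal"
  then have "1 \<in> null_ideal"
    using null_ideal_mult_left ring_inv_left[OF assms] by metis
  then show False
    using coef_one[of "{}"] unfolding null_ideal_iff by auto
qed

text \<open>Each averaging step multiplies the coordinate at \<open>B\<close> by \<open>2\<close> or
  by \<open>0\<close>, according to the parity of \<open>card (B - {a})\<close>. The scalar
  coordinate is always doubled and so survives, and coordinates already killed stay zero.\<close>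

lemma jacobson_radical_averaging:
  assumes "finite D" "D \<subseteq> idx - null_idx" "y \<in> jacobson_radical" "y \<notin> null_ideal"
  shows "\<exists>x\<in>jacobson_radical. coef {} x \<noteq> 0 \<and>
    (\<forall>B\<subseteq>idx. coef B x \<noteq> 0 \<longrightarrow> (\<forall>a\<in>D. even (card (B - {a}))))"
  using assms(1,2)
proof (induction D)
  case empty
  obtain A where A: "A \<subseteq> idx" "A \<inter> null_idx = {}" "coef A y \<noteq> 0"
    using assms(4) unfolding null_ideal_iff by auto
  \<comment> \<open>Multiplying by \<open>basis_elt A\<close> brings the coordinate at
    \<open>A\<close> to the scalar position; its square is a nonzero scalar since \<open>A\<close>
    avoids the null indices.\<close>
  have "coef {} (basis_elt A * y) \<noteq> 0"
    using coef_basis_elt_mult[OF A(1) A(1), of y] A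
      coef_basis_elt_mult_basis_elt_eq_0_iff[OF A(1) A(1)] by simp
  moreover have "basis_elt A * y \<in> jacobson_radical"
    using assms(3) jacobson_radical_left_ideal unfolding left_ideal_def by blast
  ultimately show ?case by blast
next
  case (insert a D)
  then have a: "a \<in> idx" "\<eta> a \<noteq> 0"
    by (auto simp: null_idx_def)
  obtain x where x: "x \<in> jacobson_radical" "coef {} x \<noteq> 0"
    and x_even: "\<And>B b. B \<subseteq> idx \<Longrightarrow> coef B x \<noteq> 0 \<Longrightarrow> b \<in> D \<Longrightarrow> even (card (B - {b}))"
    using insert by auto
  \<comment> \<open>The added term is the conjugate of \<open>x\<close> by \<open>e a\<close>,
    because the inverse of \<open>e a\<close> is \<open>inverse (\<eta> a) *s e a\<close>.\<close>
  define x' where "x' = x + inverse (\<eta> a) *s (e a * x * e a)"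
  have "coef B (e a * x * e a) = (-1) ^ card (B - {a}) * \<eta> a * coef B x" if "B \<subseteq> idx" for B
  proof (induction x rule: basis_elt_induct)
    case (basis C)
    then show ?case
      using that e_mult_basis_elt_mult_e[OF basis a(1)] by (simp add: coef_basis_elt)
  qed (simp_all add: distrib_left distrib_right scale_mult_left scale_mult_right)
  then have coef_x': "coef B x' = (1 + (-1) ^ card (B - {a})) * coef B x" if "B \<subseteq> idx" for B
    using that a(2) by (simp add: x'_def distrib_right)
  have "e a * (inverse (\<eta> a) *s e a) = 1" "(inverse (\<eta> a) *s e a) * e a = 1"
    using a e_square[OF two_neq_zero a(1)] by (simp_all add: scale_mult_left scale_mult_right)
  then have "ring_unit (e a)"
    using ring_unitI by blast
  then have "(inverse (\<eta> a) *s e a) * x * e a \<in> jacobson_radical"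
    using x(1) jacobson_radical_mult_unit jacobson_radical_left_ideal
    unfolding left_ideal_def by blast
  then have "x' \<in> jacobson_radical"
    using x(1) jacobson_radical_left_ideal[where 'a = 'a]
    unfolding left_ideal_def x'_def by (simp add: scale_mult_left)
  moreover have "coef {} x' \<noteq> 0"
    using x(2) two_neq_zero coef_x'[of "{}"] by simp
  moreover have "even (card (B - {b}))" if "B \<subseteq> idx" "coef B x' \<noteq> 0" "b \<in> insert a D" for B b
  proof (cases "b = a")
    case True
    then show ?thesis
      using that coef_x'[of B] by (cases "even (card (B - {a}))") auto
  next
    case False
    then show ?thesis
      using that coef_x'[of B] x_even by auto
  qed
  ultimately show ?case by blast
qed

text \<open>One inclusion is the unit criterion applied to the nilpotent null ideal. For the other,
  averaging over all non-null generators leaves, modulo the null ideal and up to a scalar, an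
  element \<open>1 + w\<close> of the radical with \<open>w * w\<close> scalar, which is
  impossible.\<close>

lemma jacobson_radical_eq: "jacobson_radical = null_ideal"
proof
  show "null_ideal \<subseteq> jacobson_radical"
    using jacobson_radicalI null_ideal_mult_left ring_unit_one_diff_null_power by blast
  note ideal = jacobson_radical_left_ideal[unfolded left_ideal_def]
  have scale_rad: "c *s x \<in> jacobson_radical" if "x \<in> jacobson_radical" for c x
  proof -
    have "(c *s 1) * x \<in> jacobson_radical"
      using that ideal by blast
    then show ?thesis by (simp add: scale_mult_left)
  qed
  show "jacobson_radical \<subseteq> null_ideal"
  proof (rule ccontr)
    define M where "M = idx - null_idx"
    have M: "M \<subseteq> idx" "finite M" "M \<inter> null_idx = {}"
      unfolding M_def by auto
    assume "\<not> jacobson_radical \<subseteq> null_ideal"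
    then obtain y where "y \<in> jacobson_radical" "y \<notin> null_ideal"
      by blast
    then have "\<exists>x\<in>jacobson_radical. coef {} x \<noteq> 0 \<and>
        (\<forall>B\<subseteq>idx. coef B x \<noteq> 0 \<longrightarrow> (\<forall>a\<in>M. even (card (B - {a}))))"
      using M(2) by (intro jacobson_radical_averaging) (auto simp: M_def)
    then obtain x where x: "x \<in> jacobson_radical" "coef {} x \<noteq> 0"
      and x_even: "\<And>B b. B \<subseteq> idx \<Longrightarrow> coef B x \<noteq> 0 \<Longrightarrow> b \<in> M \<Longrightarrow> even (card (B - {b}))"
      by auto
    \<comment> \<open>If \<open>card B\<close> is even, deleting an element of \<open>B\<close>
      would make it odd, so \<open>B\<close> is empty. If it is odd, every index of \<open>M\<close>
      has to be deleted from \<open>B\<close> to make it even, so \<open>B = M\<close>.\<close>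
    have supp: "B = {} \<or> B = M" if B: "B \<subseteq> idx" "B \<inter> null_idx = {}" "coef B x \<noteq> 0" for B
    proof -
      have BM: "B \<subseteq> M" "finite B"
        using B M_def finite_subset_idx by auto
      show ?thesis
      proof (cases "even (card B)")
        case True
        have "b \<notin> B" for b
        proof
          assume "b \<in> B"
          then have "card B = Suc (card (B - {b}))"
            by (rule card_Suc_Diff1[OF BM(2), symmetric])
          then show False
            using True x_even[OF B(1,3), of b] BM \<open>b \<in> B\<close> by auto
        qed
        then show ?thesis by blast
      next
        case False
        have "b \<in> B" if "b \<in> M" for b
          using False x_even[OF B(1,3) that] by (cases "b \<in> B") auto
        then show ?thesis using BM by blast
      qed
    qed
    \<comment> \<open>For empty \<open>M\<close> the monomial of \<open>M\<close> is
      \<open>1\<close>, whose coordinate is already the scalar one; the value \<open>0\<close>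
      avoids counting it twice.\<close>
    define t where "t = (if M = {} then 0 else coef M x / coef {} x)"
    define w where "w = t *s basis_elt M"
    have coef_w: "coef {} w = 0"
      using M by (simp add: w_def t_def coef_basis_elt)
    obtain d where d: "w * w = d *s 1"
      using basis_elt_mult[OF M(1) M(1)] by (auto simp: w_def scale_mult_left scale_mult_right)
    have "inverse (coef {} x) *s x - (1 + w) \<in> null_ideal"
      unfolding null_ideal_iff
    proof (intro allI impI)
      fix A assume A: "A \<subseteq> idx" "A \<inter> null_idx = {}"
      consider "A = {}" | "A \<noteq> {}" "A = M" | "A \<noteq> {}" "A \<noteq> M" by blast
      then show "coef A (inverse (coef {} x) *s x - (1 + w)) = 0"
      proof cases
        case 1
        then show ?thesis using x(2) coef_w by (simp add: coef_one)
      next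
        case 2
        then show ?thesis
          using A by (simp add: coef_one w_def t_def coef_basis_elt divide_inverse mult.commute)
      next
        case 3
        then show ?thesis
          using A M supp[OF A] by (auto simp: coef_one w_def coef_basis_elt)
      qed
    qed
    then have "inverse (coef {} x) *s x - (1 + w) \<in> jacobson_radical"
      using \<open>null_ideal \<subseteq> jacobson_radical\<close> by blast
    then have "- 1 * (inverse (coef {} x) *s x - (1 + w)) + inverse (coef {} x) *s x \<in> jacobson_radical"
      using x(1) scale_rad ideal by blast
    then have w_rad: "1 + w \<in> jacobson_radical"
      by simp
    \<comment> \<open>This puts the scalar \<open>1 - d\<close> into the radical, which is absurd
      unless \<open>d = 1\<close>.\<close>
    have zero_div: "(1 - w) * (1 + w) = (1 - d) *s 1"
      using d by (simp add: algebra_simps scale_left_diff_distrib)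
    show False
    proof (cases "d = 1")
      case False
      have "inverse (1 - d) *s ((1 - w) * (1 + w)) \<in> jacobson_radical"
        using w_rad scale_rad ideal by blast
      then show False
        using False by (simp add: zero_div one_notin_jacobson_radical)
    next
      case True
      text \<open>Now \<open>(1 + w) / 2\<close> is an idempotent in the radical, hence zero.\<close>
      define f where "f = (1 / 2) *s (1 + w)"
      have "1 - f = (1 / 2) *s (1 - w)"
        unfolding f_def by (rule diff_half_add)
      then have "(1 - f) * f = 0"
        using zero_div True by (simp add: f_def scale_mult_left scale_mult_right)
      moreover obtain s where "s * (1 - f) = 1"
        using jacobson_radical_left_inverse scale_rad[OF w_rad] f_def by blast
      ultimately have "f = 0"
        by (metis mult.assoc mult.left_neutral mult_zero_right)
      moreover have "coef {} f = 1 / 2"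
        using coef_w by (simp add: f_def coef_one)
      ultimately show False
        using two_neq_zero by simp
    qed
  qed
qed

section \<open>The pseudoscalar\<close>

definition pseudoscalar :: 'a (\<open>\<omega>\<close>) where
  "\<omega> = basis_elt idx"

lemma grade_0_eq: "grade 0 = range (\<lambda>\<alpha>. \<alpha> *s 1)"
proof -
  have "{basis_elt A |A. A \<subseteq> idx \<and> card A = 0} = {1}"
    using finite_subset_idx by (force intro: exI[of _ "{}"])
  then show ?thesis
    unfolding grade_def by (simp add: span_singleton)
qed

lemma grade_n_eq: "grade n = range (\<lambda>\<beta>. \<beta> *s \<omega>)"
proof -
  have "A \<subseteq> idx \<and> card A = n \<longleftrightarrow> A = idx" for A
    using card_subset_eq[of idx A] by auto
  then have "{basis_elt A |A. A \<subseteq> idx \<and> card A = n} = {\<omega>}"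
    unfolding pseudoscalar_def by (simp only: Collect_conj_eq simp_thms) simp
  then show ?thesis
    unfolding grade_def by (simp add: span_singleton)
qed

lemma grade_0n_iff: "U \<in> grade_0n \<longleftrightarrow> (\<exists>\<alpha> \<beta>. U = \<alpha> *s 1 + \<beta> *s \<omega>)"
  unfolding grade_0n_def grade_0_eq grade_n_eq set_plus_def by auto

lemma coef_pseudoscalar: "A \<subseteq> idx \<Longrightarrow> coef A \<omega> = (if A = idx then 1 else 0)"
  unfolding pseudoscalar_def by (rule coef_basis_elt) auto

text \<open>Since \<open>n \<ge> 1\<close>, the index sets \<open>{}\<close> and \<open>idx\<close>
  differ, so \<open>1\<close> and \<open>\<omega>\<close> are two different basis monomials.\<close>

lemma scalar_pseudoscalar_eq_0_iff: "\<alpha> *s 1 + \<beta> *s \<omega> = 0 \<longleftrightarrow> \<alpha> = 0 \<and> \<beta> = 0"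
proof
  assume eq: "\<alpha> *s 1 + \<beta> *s \<omega> = 0"
  have "idx \<noteq> {}" using dim_pos by auto
  then have "coef {} 1 = 1" "coef idx 1 = 0" "coef {} \<omega> = 0" "coef idx \<omega> = 1"
    using coef_one[of "{}"] coef_one[of idx] coef_pseudoscalar[of "{}"] coef_pseudoscalar[of idx]
    by (simp_all del: One_nat_def)
  then have "coef {} (\<alpha> *s 1 + \<beta> *s \<omega>) = \<alpha>" "coef idx (\<alpha> *s 1 + \<beta> *s \<omega>) = \<beta>"
    by (simp_all del: One_nat_def)
  then show "\<alpha> = 0 \<and> \<beta> = 0"
    unfolding eq by simp
qed simp

lemma pseudoscalar_square: "\<exists>d. \<omega> * \<omega> = d *s 1 \<and> (d = 0 \<longleftrightarrow> null_idx \<noteq> {})"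
proof -
  have "idx \<inter> idx \<inter> null_idx = null_idx" by (auto simp: null_idx_def)
  then show ?thesis
    using basis_elt_mult[of idx idx] unfolding pseudoscalar_def by simp
qed

lemma scalar_pseudoscalar_square:
  assumes "\<omega> * \<omega> = d *s 1"
  shows "(\<alpha> *s 1 + \<beta> *s \<omega>) * (\<alpha> *s 1 + \<beta> *s \<omega>) =
    (\<alpha> * \<alpha> + \<beta> * \<beta> * d) *s 1 + (2 * \<alpha> * \<beta>) *s \<omega>"
proof -
  have "(\<alpha> *s 1 + \<beta> *s \<omega>) * (\<alpha> *s 1 + \<beta> *s \<omega>) =
      (\<alpha> * \<alpha> + \<beta> * \<beta> * d) *s 1 + ((\<alpha> * \<beta>) *s \<omega> + (\<alpha> * \<beta>) *s \<omega>)"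
    by (simp add: distrib_left distrib_right scale_mult_left scale_mult_right assms mult_ac
        scale_left_distrib scale_right_distrib add_ac)
  also have "(\<alpha> * \<beta>) *s \<omega> + (\<alpha> * \<beta>) *s \<omega> = (2 * \<alpha> * \<beta>) *s \<omega>"
    by (simp only: mult_2 distrib_right scale_left_distrib)
  finally show ?thesis .
qed

lemma hat_pseudoscalar: "hat \<omega> = (- 1) ^ n *s \<omega>"
  unfolding pseudoscalar_def using hat_basis_elt[of idx] by simp

text \<open>The sign is that of \<open>n - 1\<close> transpositions, written as
  \<open>- ((- 1) ^ n)\<close> to avoid subtraction of naturals.\<close>

lemma pseudoscalar_mult_e:
  assumes "a \<in> idx"
  shows "\<omega> * e a = - ((- 1) ^ n *s (e a * \<omega>))"
proof -
  have "Suc (card (idx - {a})) = n"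
    using card_Suc_Diff1[of idx a] assms by simp
  then have "(- 1 :: 'f) ^ n = - ((- 1) ^ card (idx - {a}))"
    by (metis power_Suc mult_minus1)
  then show ?thesis
    using basis_elt_mult_e[of idx a] assms unfolding pseudoscalar_def by simp
qed

lemma pseudoscalar_commute:
  assumes "odd n"
  shows "\<omega> * x = x * \<omega>"
proof -
  have "{x. \<omega> * x = x * \<omega>} = UNIV"
  proof (rule generators)
    show "subspace {x. \<omega> * x = x * \<omega>}"
      by (intro subspaceI) (simp_all add: distrib_left distrib_right scale_mult_left scale_mult_right)
    show "e a \<in> {x. \<omega> * x = x * \<omega>}" if "a \<in> {1..n}" for a
      using pseudoscalar_mult_e[OF that] assms by simp
    show "x * y \<in> {x. \<omega> * x = x * \<omega>}" if "x \<in> {x. \<omega> * x = x * \<omega>}" "y \<in> {x. \<omega> * x = x * \<omega>}" for x y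
      using that by simp (metis mult.assoc)
  qed simp
  then show ?thesis by blast
qed

text \<open>For even \<open>n\<close> each generator anticommutes with \<open>\<omega>\<close>, and
  \<open>hat\<close> negates generators; the relation passes to products because \<open>hat\<close>
  is multiplicative.\<close>

lemma pseudoscalar_commute_hat:
  assumes "even n"
  shows "\<omega> * x = hat x * \<omega>"
proof -
  have "{x. \<omega> * x = hat x * \<omega>} = UNIV"
  proof (rule generators)
    show "subspace {x. \<omega> * x = hat x * \<omega>}"
      by (intro subspaceI) (simp_all add: distrib_left distrib_right scale_mult_left scale_mult_right)
    show "e a \<in> {x. \<omega> * x = hat x * \<omega>}" if a: "a \<in> {1..n}" for a
    proof -
      have "hat (e a) = - e a"
        using hat_basis_elt[of "{a}"] a by simp
      then show ?thesis
        using pseudoscalar_mult_e[OF a] assms by simp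
    qed
    show "x * y \<in> {x. \<omega> * x = hat x * \<omega>}"
      if "x \<in> {x. \<omega> * x = hat x * \<omega>}" "y \<in> {x. \<omega> * x = hat x * \<omega>}" for x y
      using that by simp (metis mult.assoc)
  qed simp
  then show ?thesis by blast
qed

text \<open>Multiplication by \<open>\<omega>\<close> sends the monomial of \<open>A\<close> to a
  multiple of that of its complement, and to zero exactly when \<open>A\<close> meets
  \<open>null_idx\<close>. Different monomials do not interfere, so coordinates can be tested one at
  a time.\<close>

lemma mult_pseudoscalar_eq_0_iff: "x * \<omega> = 0 \<longleftrightarrow> x \<in> null_ideal"
proof -
  have coef: "coef (sym_diff A idx) (x * \<omega>) = 0 \<longleftrightarrow> (A \<inter> null_idx = {} \<longrightarrow> coef A x = 0)"
    if A: "A \<subseteq> idx" for A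
  proof -
    have "A \<inter> idx \<inter> null_idx = A \<inter> null_idx"
      using A by blast
    then show ?thesis
      using coef_mult_basis_elt[OF A order_refl, of x]
        coef_basis_elt_mult_basis_elt_eq_0_iff[OF A order_refl]
      unfolding pseudoscalar_def by auto
  qed
  show ?thesis
  proof
    assume "x * \<omega> = 0"
    then show "x \<in> null_ideal"
      using coef unfolding null_ideal_iff by (metis coef_zero)
  next
    assume x: "x \<in> null_ideal"
    show "x * \<omega> = 0"
    proof (rule coef_eqI)
      fix B assume B: "B \<subseteq> idx"
      have "coef (sym_diff (idx - B) idx) (x * \<omega>) = 0"
        using coef[of "idx - B"] x unfolding null_ideal_iff by blast
      moreover have "sym_diff (idx - B) idx = B"
        using B by blast
      ultimately show "coef B (x * \<omega>) = coef B 0"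
        by (metis coef_zero)
    qed
  qed
qed

lemma pseudoscalar_in_null_ideal: "null_idx \<noteq> {} \<Longrightarrow> \<omega> \<in> null_ideal"
  using pseudoscalar_square mult_pseudoscalar_eq_0_iff by fastforce

section \<open>The center\<close>

text \<open>Compare \<open>z * e a\<close> with \<open>e a * z\<close> at the index set
  \<open>sym_diff {a} A\<close>: where the monomial anticommutes with \<open>e a\<close> and the
  product is nonzero, the coordinate of \<open>z\<close> equals its own negative.\<close>

lemma ring_center_support:
  assumes z: "z \<in> ring_center" and A: "A \<subseteq> idx" "coef A z \<noteq> 0"
  shows "even (card A) \<and> A \<subseteq> null_idx \<or> odd n \<and> A = idx"
proof -
  have sign: "a \<in> A \<inter> null_idx \<or> even (card (A - {a}))" if a: "a \<in> idx" for a
  proof (rule ccontr)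
    assume contra: "\<not> ?thesis"
    have a': "{a} \<subseteq> idx" using a by simp
    let ?c = "coef (sym_diff {a} A) (e a * basis_elt A)"
    have comm: "sym_diff A {a} = sym_diff {a} A" by blast
    have "?c \<noteq> 0"
      using coef_basis_elt_mult_basis_elt_eq_0_iff[OF a' A(1)] contra by auto
    moreover have "coef (sym_diff {a} A) (z * e a) = coef A z * (- ?c)"
      using coef_mult_basis_elt[OF A(1) a', of z] contra basis_elt_mult_e[OF A(1) a]
      unfolding comm by simp
    moreover have "coef (sym_diff {a} A) (e a * z) = coef A z * ?c"
      using coef_basis_elt_mult[OF A(1) a', of z] by simp
    moreover have "z * e a = e a * z"
      using z unfolding ring_center_def by blast
    ultimately have "2 * (coef A z * ?c) = 0"
      by (simp add: eq_neg_iff_add_eq_0 flip: mult_2)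
    then show False
      using \<open>?c \<noteq> 0\<close> A(2) two_neq_zero by auto
  qed
  have fin: "finite A" using A(1) finite_subset_idx by blast
  show ?thesis
  proof (cases "even (card A)")
    case True
    have "a \<in> null_idx" if "a \<in> A" for a
    proof -
      have "odd (card (A - {a}))"
        using card_Suc_Diff1[OF fin that] True by (metis even_Suc)
      then show ?thesis
        using sign A(1) that by blast
    qed
    then show ?thesis using True by blast
  next
    case False
    have "a \<in> A" if "a \<in> idx" for a
      using sign[OF that] False by (cases "a \<in> A") auto
    then have "A = idx" using A(1) by blast
    then show ?thesis using False by simp
  qed
qed

lemma hat_center_of_even:
  assumes "even n" "z \<in> ring_center"
  shows "hat z = z"
proof (rule coef_eqI)
  fix A assume "A \<subseteq> idx"
  then show "coef A (hat z) = coef A z"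
    using ring_center_support[OF assms(2)] assms(1) by (cases "coef A z = 0") (auto simp: coef_hat)
qed

text \<open>A central \<open>z\<close> is even apart from its pseudoscalar coordinate, so
  \<open>hat z\<close> differs from \<open>z\<close> by a multiple of \<open>\<omega>\<close>. It
  remains to write \<open>\<omega>\<close> as a multiple of \<open>z\<close> by an element of
  \<open>grade_0n\<close>.\<close>

lemma hat_center_of_odd:
  assumes n: "odd n" and z: "z \<in> ring_center" "ring_unit z"
  shows "\<exists>\<alpha> \<beta>. hat z = (\<alpha> *s 1 + \<beta> *s \<omega>) * z"
proof -
  define l b where "l = coef {} z" and "b = coef idx z"
  have hat_z: "hat z = z - (2 * b) *s \<omega>"
  proof (rule coef_eqI)
    fix A assume A: "A \<subseteq> idx"
    show "coef A (hat z) = coef A (z - (2 * b) *s \<omega>)"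
    proof (cases "A = idx")
      case True
      then show ?thesis using n coef_hat[OF A] coef_pseudoscalar[OF A] by (simp add: b_def)
    next
      case False
      then show ?thesis
        using ring_center_support[OF z(1) A] coef_hat[OF A] coef_pseudoscalar[OF A]
        by (cases "coef A z = 0") auto
    qed
  qed
  have "\<exists>\<alpha> \<beta>. \<omega> = (\<alpha> *s 1 + \<beta> *s \<omega>) * z"
  proof (cases "null_idx = {}")
    case True
    obtain d where d: "\<omega> * \<omega> = d *s 1" "d \<noteq> 0"
      using pseudoscalar_square True by blast
    have z_eq: "z = l *s 1 + b *s \<omega>"
    proof (rule coef_eqI)
      fix A assume A: "A \<subseteq> idx"
      have "idx \<noteq> {}" using dim_pos by auto
      then show "coef A z = coef A (l *s 1 + b *s \<omega>)"
        using ring_center_support[OF z(1) A] True coef_pseudoscalar[OF A] coef_one[OF A]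
        by (cases "coef A z = 0") (auto simp: l_def b_def)
    qed
    \<comment> \<open>The norm of \<open>z = l *s 1 + b *s \<omega>\<close>, that is, its product
      with the conjugate \<open>l *s 1 - b *s \<omega>\<close>.\<close>
    define k where "k = l * l - b * b * d"
    have conj: "(l *s 1 + (- b) *s \<omega>) * z = k *s 1"
      unfolding z_eq k_def
      by (simp add: distrib_left distrib_right scale_mult_left scale_mult_right d mult_ac
          scale_left_diff_distrib algebra_simps)
    have "k \<noteq> 0"
    proof
      assume "k = 0"
      then have "(l *s 1 + (- b) *s \<omega>) * z * ring_inv z = 0"
        using conj by simp
      then have "l *s 1 + (- b) *s \<omega> = 0"
        using z(2) by (simp add: mult.assoc ring_inv_right)
      then have "z = 0"
        using scalar_pseudoscalar_eq_0_iff[of l "- b"] z_eq by simp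
      then show False
        using z(2) by (metis mult_zero_left ring_inv_right zero_neq_one)
    qed
    \<comment> \<open>Dividing the conjugate by \<open>k\<close> inverts \<open>z\<close>; the
      coefficients come from expanding \<open>\<omega>\<close> times that inverse.\<close>
    have "(- (b * d) / k) *s 1 + (l / k) *s \<omega> = (1 / k) *s (\<omega> * (l *s 1 + (- b) *s \<omega>))"
      by (simp add: distrib_left scale_mult_right d algebra_simps scale_right_diff_distrib)
    then have "((- (b * d) / k) *s 1 + (l / k) *s \<omega>) * z = (1 / k) *s (\<omega> * ((l *s 1 + (- b) *s \<omega>) * z))"
      by (simp only: scale_mult_left mult.assoc)
    also have "\<dots> = \<omega>"
      unfolding conj using \<open>k \<noteq> 0\<close> by (simp add: scale_mult_right)
    finally show ?thesis by metis
  next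
    case False
    \<comment> \<open>Now \<open>idx\<close> contains a null index, so the scalar coordinate is the
      only one of \<open>z\<close> outside the null ideal. As \<omega> kills that ideal,
      \<open>z\<close> acts on \<omega> as the scalar \<open>l\<close>, nonzero because
      \<open>z\<close> is a unit.\<close>
    have "z - l *s 1 \<in> null_ideal"
      unfolding null_ideal_iff
    proof (intro allI impI)
      fix A assume A: "A \<subseteq> idx" "A \<inter> null_idx = {}"
      have "idx \<inter> null_idx \<noteq> {}"
        using False by (auto simp: null_idx_def)
      then show "coef A (z - l *s 1) = 0"
        using ring_center_support[OF z(1) A(1)] A(2) coef_one[OF A(1)]
        by (cases "coef A z = 0") (auto simp: l_def)
    qed
    moreover have "l \<noteq> 0"
      using calculation ring_unit_notin_null_ideal[OF z(2)] by auto
    moreover have "z * \<omega> = l *s \<omega>"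
      using calculation(1) mult_pseudoscalar_eq_0_iff[of "z - l *s 1"]
      by (simp add: left_diff_distrib scale_mult_left)
    ultimately have "\<omega> = (0 *s 1 + (1 / l) *s \<omega>) * z"
      using pseudoscalar_commute[OF n, of z] by (simp add: scale_mult_left)
    then show ?thesis by metis
  qed
  then obtain \<alpha> \<beta> where "\<omega> = (\<alpha> *s 1 + \<beta> *s \<omega>) * z" by blast
  then have "hat z = 1 *s z - (2 * b) *s ((\<alpha> *s 1 + \<beta> *s \<omega>) * z)"
    unfolding hat_z by simp
  also have "\<dots> = ((1 - 2 * b * \<alpha>) *s 1 + (- (2 * b * \<beta>)) *s \<omega>) * z"
    by (simp add: distrib_right scale_mult_left scale_right_distrib scale_left_diff_distrib
        left_diff_distrib)
  finally show ?thesis by blast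
qed

section \<open>The groups\<close>

lemma P_pm_hat:
  assumes "S \<in> P_pm"
  shows "\<exists>c. hat S = c *s S"
proof -
  have "hat S = 1 *s S \<or> hat S = (- 1) *s S"
    using assms by (simp add: P_pm_iff)
  then show ?thesis by blast
qed

text \<open>A factor of scalar plus radical element changes \<open>hat S = c *s S\<close> only
  modulo the radical. Conversely the relation puts one parity part \<open>j\<close> of
  \<open>T\<close> into the radical; the other part \<open>S\<close> is then a unit and
  \<open>T = S * (1 + ring_inv S * j)\<close>.\<close>

lemma P_pm_rad_iff: "T \<in> P_pm_rad \<longleftrightarrow> ring_unit T \<and> (\<exists>c. hat T - c *s T \<in> null_ideal)"
proof
  assume "T \<in> P_pm_rad"
  then obtain S Z where T: "T = S * Z" and S: "S \<in> P_pm" and Z: "Z \<in> grade 0 + jacobson_radical" "ring_unit Z"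
    unfolding P_pm_rad_def units_in_def set_times_def by auto
  obtain \<alpha> j where Z_eq: "Z = \<alpha> *s 1 + j" and j: "j \<in> null_ideal"
    using Z(1) unfolding grade_0_eq jacobson_radical_eq set_plus_def by auto
  obtain c where c: "hat S = c *s S"
    using P_pm_hat[OF S] by blast
  have "hat T - c *s T = c *s (S * (hat j - j))"
    unfolding T Z_eq by (simp add: c distrib_left right_diff_distrib scale_mult_left scale_right_distrib
        scale_right_diff_distrib)
  also have "\<dots> \<in> null_ideal"
    using j by (intro null_power_scale null_ideal_mult_left null_power_diff null_power_hat)
  finally show "ring_unit T \<and> (\<exists>c. hat T - c *s T \<in> null_ideal)"
    using ring_unit_mult T S Z(2) unfolding P_pm_iff by blast
next
  assume "ring_unit T \<and> (\<exists>c. hat T - c *s T \<in> null_ideal)"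
  then obtain c where T: "ring_unit T" and c: "hat T - c *s T \<in> null_ideal" by blast
  have "even_part T \<in> null_ideal \<or> odd_part T \<in> null_ideal"
  proof (cases "c = 1")
    case True
    then have "(- (1 / 2)) *s (hat T - T) \<in> null_ideal"
      using c by (intro null_power_scale) simp
    then show ?thesis
      by (simp add: odd_part_eq scale_right_diff_distrib)
  next
    case False
    \<comment> \<open>Adding the image under \<open>hat\<close> isolates the even part, with the
      factor \<open>1 - c\<close>, which is nonzero here.\<close>
    have "hat (hat T - c *s T) + (hat T - c *s T) \<in> null_ideal"
      using c by (intro null_power_add null_power_hat)
    also have "hat (hat T - c *s T) + (hat T - c *s T) = (1 - c) *s (T + hat T)"
      by (simp add: scale_left_diff_distrib scale_right_distrib algebra_simps)
    finally have "T + hat T \<in> null_ideal"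
      using False null_power_scale_iff by simp
    then show ?thesis
      unfolding even_part_eq using null_power_scale by blast
  qed
  then obtain S j where S: "hat S = S \<or> hat S = - S" and j: "j \<in> null_ideal" and T_eq: "T = S + j"
    by (metis hat_even_part hat_odd_part even_plus_odd_part add.commute)
  have S_unit: "ring_unit S"
    using ring_unit_diff_null_ideal[OF T j] T_eq by simp
  define Z where "Z = 1 *s 1 + ring_inv S * j"
  have Sj: "ring_inv S * j \<in> null_ideal"
    using j by (rule null_ideal_mult_left)
  have "T = S * Z"
    unfolding T_eq Z_def by (simp add: distrib_left ring_inv_right_assoc S_unit)
  moreover have "ring_unit Z"
    using ring_unit_one_diff_null_power[OF null_power_uminus[OF Sj]] by (simp add: Z_def)
  moreover have "Z \<in> grade 0 + jacobson_radical"
    unfolding Z_def jacobson_radical_eq grade_0_eq by (intro set_plus_intro Sj rangeI)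
  moreover have "S \<in> P_pm"
    unfolding P_pm_iff using S S_unit by blast
  ultimately show "T \<in> P_pm_rad"
    unfolding P_pm_rad_def units_in_def by (auto intro: set_times_intro)
qed

text \<open>Forward, the behaviour of \<open>hat\<close> on central units supplies the factor.
  Backward, for even \<open>n\<close> applying \<open>hat\<close> twice forces \<open>hat T\<close>
  to be \<open>T\<close> or \<open>- T\<close>; for odd \<open>n\<close> comparing parities exhibits
  one part of \<open>T\<close> as a multiple of the other by \<open>\<omega>\<close>.\<close>

lemma P_iff_hat: "T \<in> P \<longleftrightarrow> ring_unit T \<and> (\<exists>\<alpha> \<beta>. hat T = (\<alpha> *s 1 + \<beta> *s \<omega>) * T)"
proof
  assume "T \<in> P"
  then obtain S z where T: "T = S * z" and S: "S \<in> P_pm" and z: "z \<in> ring_center" "ring_unit z"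
    unfolding P_def units_in_def set_times_def by auto
  obtain c where c: "hat S = c *s S"
    using P_pm_hat[OF S] by blast
  have "\<exists>\<alpha> \<beta>. hat T = (\<alpha> *s 1 + \<beta> *s \<omega>) * T"
  proof (cases "even n")
    case True
    then have "hat T = (c *s 1 + 0 *s \<omega>) * T"
      using hat_center_of_even[OF True z(1)] by (simp add: T c scale_mult_left)
    then show ?thesis by blast
  next
    case False
    then obtain \<alpha> \<beta> where "hat z = (\<alpha> *s 1 + \<beta> *s \<omega>) * z"
      using hat_center_of_odd z by blast
    then have "hat T = c *s (S * (\<alpha> *s 1 + \<beta> *s \<omega>) * z)"
      by (simp add: T c scale_mult_left mult.assoc)
    also have "S * (\<alpha> *s 1 + \<beta> *s \<omega>) = (\<alpha> *s 1 + \<beta> *s \<omega>) * S"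
      using pseudoscalar_commute[OF False, of S]
      by (simp add: distrib_left distrib_right scale_mult_left scale_mult_right)
    finally have "hat T = ((c * \<alpha>) *s 1 + (c * \<beta>) *s \<omega>) * T"
      by (simp add: T mult.assoc distrib_left distrib_right scale_mult_left scale_right_distrib)
    then show ?thesis by blast
  qed
  then show "ring_unit T \<and> (\<exists>\<alpha> \<beta>. hat T = (\<alpha> *s 1 + \<beta> *s \<omega>) * T)"
    using ring_unit_mult T S z(2) unfolding P_pm_iff by blast
next
  assume "ring_unit T \<and> (\<exists>\<alpha> \<beta>. hat T = (\<alpha> *s 1 + \<beta> *s \<omega>) * T)"
  then obtain \<alpha> \<beta> where T: "ring_unit T" and hat_T: "hat T = (\<alpha> *s 1 + \<beta> *s \<omega>) * T" by blast
  have P_I: "T \<in> P" if "T = z * S" "z \<in> ring_center" "hat S = S \<or> hat S = - S" for z S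
  proof -
    have "ring_unit z" "ring_unit S"
      using ring_unit_central_factor T that by blast+
    moreover have "T = S * z"
      using that unfolding ring_center_def by simp
    ultimately show ?thesis
      using that unfolding P_def units_in_def P_pm_iff[symmetric]
      by (auto simp: P_pm_iff intro!: set_times_intro)
  qed
  have center: "x *s 1 \<in> ring_center" for x
    by (simp add: ring_center_def scale_mult_left scale_mult_right)
  show "T \<in> P"
  proof (cases "even n")
    case True
    obtain d where d: "\<omega> * \<omega> = d *s 1"
      using pseudoscalar_square by blast
    \<comment> \<open>For even \<open>n\<close> the factor
      \<open>\<alpha> *s 1 + \<beta> *s \<omega>\<close> is fixed by \<open>hat\<close>, so its
      square acts on the unit \<open>T\<close> as the identity and equals \<open>1\<close>.\<close>
    have "T = hat ((\<alpha> *s 1 + \<beta> *s \<omega>) * T)"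
      unfolding hat_T[symmetric] by simp
    also have "\<dots> = (\<alpha> *s 1 + \<beta> *s \<omega>) * hat T"
      using True by (simp add: hat_pseudoscalar)
    also have "\<dots> = (\<alpha> *s 1 + \<beta> *s \<omega>) * (\<alpha> *s 1 + \<beta> *s \<omega>) * T"
      by (simp add: hat_T mult.assoc)
    finally have "1 * T = (\<alpha> *s 1 + \<beta> *s \<omega>) * (\<alpha> *s 1 + \<beta> *s \<omega>) * T"
      by simp
    then have one: "1 = (\<alpha> *s 1 + \<beta> *s \<omega>) * (\<alpha> *s 1 + \<beta> *s \<omega>)"
      using T by (metis mult.assoc mult.right_neutral ring_inv_right)
    from one have "1 = (\<alpha> * \<alpha> + \<beta> * \<beta> * d) *s 1 + (2 * \<alpha> * \<beta>) *s \<omega>"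
      unfolding scalar_pseudoscalar_square[OF d] .
    then have "(\<alpha> * \<alpha> + \<beta> * \<beta> * d - 1) *s 1 + (2 * \<alpha> * \<beta>) *s \<omega> = 0"
      by (simp add: scale_left_diff_distrib algebra_simps)
    then have "\<alpha> * \<alpha> + \<beta> * \<beta> * d = 1" and "\<alpha> * \<beta> = 0"
      using scalar_pseudoscalar_eq_0_iff two_neq_zero by auto
    moreover have "\<alpha> \<noteq> 0"
    proof
      assume "\<alpha> = 0"
      \<comment> \<open>Here \<open>\<omega> * T = hat T * \<omega>\<close> turns the relation into
        one from which the unit \<open>hat T\<close> can be cancelled, making \<open>1\<close> a
        multiple of \<open>\<omega>\<close>.\<close>
      then have "hat T = hat T * (\<beta> *s \<omega>)"
        using hat_T pseudoscalar_commute_hat[OF True, of T]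
        by (simp add: scale_mult_left scale_mult_right)
      then have "1 = \<beta> *s \<omega>"
        using ring_unit_hat[OF T] by (metis ring_inv_left ring_inv_left_assoc)
      then show False
        using scalar_pseudoscalar_eq_0_iff[of "- 1" \<beta>] by simp
    qed
    ultimately have "\<beta> = 0" "\<alpha> * \<alpha> = 1"
      by auto
    then have "hat T = T \<or> hat T = - T"
      using hat_T by (auto simp: square_eq_1_iff scale_mult_left)
    then show ?thesis
      using P_I[of "1 *s 1" T] center[of 1] by simp
  next
    case False
    have center': "1 + x *s \<omega> \<in> ring_center" for x
      using pseudoscalar_commute[OF False]
      by (simp add: ring_center_def scale_mult_left scale_mult_right distrib_left distrib_right)
    define T0 T1 where "T0 = even_part T" and "T1 = odd_part T"
    have T_eq: "T = T0 + T1" and hat_T0: "hat T0 = T0" and hat_T1: "hat T1 = - T1"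
      by (simp_all add: T0_def T1_def even_plus_odd_part)
    have rel: "T0 - T1 = (\<alpha> *s 1 + \<beta> *s \<omega>) * (T0 + T1)"
      using hat_T by (simp add: T_eq hat_T0 hat_T1)
    \<comment> \<open>For odd \<open>n\<close> the pseudoscalar is odd, so \<open>p\<close> is odd
      and \<open>q\<close> is even.\<close>
    define p q where "p = \<omega> * T0" and "q = \<omega> * T1"
    have rel1: "T0 - T1 = \<alpha> *s T0 + \<alpha> *s T1 + \<beta> *s p + \<beta> *s q"
      unfolding rel by (simp add: distrib_left distrib_right scale_mult_left p_def q_def add_ac)
    have "T0 + T1 = hat ((\<alpha> *s 1 + \<beta> *s \<omega>) * (T0 + T1))"
      unfolding rel[symmetric] by (simp add: hat_T0 hat_T1)
    also have "\<dots> = \<alpha> *s T0 - \<alpha> *s T1 - \<beta> *s p + \<beta> *s q"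
      using False by (simp add: hat_T0 hat_T1 hat_pseudoscalar distrib_left distrib_right
          left_diff_distrib right_diff_distrib scale_mult_left p_def q_def)
    finally have rel2: "T0 + T1 = \<alpha> *s T0 - \<alpha> *s T1 - \<beta> *s p + \<beta> *s q" .
    show ?thesis
    proof (cases "\<alpha> = - 1")
      case True
      \<comment> \<open>The even component of the relation, extracted by adding its image under
        \<open>hat\<close>. With \<open>\<alpha> = - 1\<close> it expresses \<open>T0\<close>
        through \<open>\<omega> * T1\<close>.\<close>
      let ?Y = "T0 - \<alpha> *s T0 - \<beta> *s q"
      have "?Y + ?Y = ((T0 - T1) - (\<alpha> *s T0 + \<alpha> *s T1 + \<beta> *s p + \<beta> *s q)) +
          ((T0 + T1) - (\<alpha> *s T0 - \<alpha> *s T1 - \<beta> *s p + \<beta> *s q))"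
        by (simp add: algebra_simps)
      also have "\<dots> = 0"
        using rel1 rel2 by simp
      finally have "(1 / 2) *s (T0 + T0) = (\<beta> / 2) *s q"
        using half_double[of ?Y] True by (simp add: scale_right_diff_distrib)
      then have "T = (1 + (\<beta> / 2) *s \<omega>) * T1"
        unfolding half_double T_eq by (simp add: distrib_right scale_mult_left q_def add.commute)
      then show ?thesis
        using P_I center' hat_T1 by blast
    next
      case False
      \<comment> \<open>The odd component of the relation, extracted by subtracting; dividing by
        \<open>1 + \<alpha>\<close> expresses \<open>T1\<close> through
        \<open>\<omega> * T0\<close>.\<close>
      let ?X = "T1 + \<alpha> *s T1 + \<beta> *s p"
      have "?X + ?X = ((\<alpha> *s T0 + \<alpha> *s T1 + \<beta> *s p + \<beta> *s q) - (T0 - T1)) -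
          ((\<alpha> *s T0 - \<alpha> *s T1 - \<beta> *s p + \<beta> *s q) - (T0 + T1))"
        by (simp add: algebra_simps)
      also have "\<dots> = 0"
        using rel1 rel2 by simp
      finally have "(1 + \<alpha>) *s T1 + \<beta> *s p = 0"
        using half_double[of ?X] by (simp add: scale_left_distrib)
      then have "(1 + \<alpha>) *s T1 = - (\<beta> *s p)"
        by (rule eq_neg_iff_add_eq_0[THEN iffD2])
      then have "(1 / (1 + \<alpha>)) *s ((1 + \<alpha>) *s T1) = (1 / (1 + \<alpha>)) *s (- (\<beta> *s p))"
        by (simp only:)
      moreover have "1 + \<alpha> \<noteq> 0"
        using False by (simp add: eq_neg_iff_add_eq_0 add.commute)
      ultimately have "T1 = (- \<beta> / (1 + \<alpha>)) *s p"
        by simp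
      then have "T = (1 + (- \<beta> / (1 + \<alpha>)) *s \<omega>) * T0"
        unfolding T_eq by (simp add: distrib_right left_diff_distrib scale_mult_left p_def)
      then show ?thesis
        using P_I center' hat_T0 by blast
    qed
  qed
qed

section \<open>The stabilizer groups as conditions on the images of \<open>1\<close> and
  \<open>\<omega>\<close>\<close>

lemma Gamma_n_iff:
  "T \<in> Gamma_n \<longleftrightarrow> ring_unit T \<and> (\<exists>\<beta>. T * \<omega> * ring_inv T = \<beta> *s \<omega>)"
proof -
  have "ad T ` grade n \<subseteq> grade n \<longleftrightarrow> ad T \<omega> \<in> grade n"
  proof
    assume "ad T ` grade n \<subseteq> grade n"
    moreover have "1 *s \<omega> \<in> grade n"
      unfolding grade_n_eq by (rule rangeI)
    ultimately show "ad T \<omega> \<in> grade n"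
      by auto
  next
    assume "ad T \<omega> \<in> grade n"
    then obtain \<gamma> where "ad T \<omega> = \<gamma> *s \<omega>"
      unfolding grade_n_eq by blast
    then have "ad T (\<beta> *s \<omega>) = (\<beta> * \<gamma>) *s \<omega>" for \<beta>
      by (simp add: ad_def scale_mult_left scale_mult_right)
    then show "ad T ` grade n \<subseteq> grade n"
      unfolding grade_n_eq by auto
  qed
  then show ?thesis
    unfolding Gamma_n_def units_in_def grade_n_eq ad_def by auto
qed

text \<open>Stated for an arbitrary linear map so that it serves \<open>ad\<close>,
  \<open>ad_check\<close> and \<open>ad_tilde\<close> alike.\<close>

lemma image_grade_0n_subset_iff:
  assumes "\<And>x y. f (x + y) = f x + f y" "\<And>c x. f (c *s x) = c *s f x"
  shows "f ` grade_0n \<subseteq> grade_0n \<longleftrightarrow> f 1 \<in> grade_0n \<and> f \<omega> \<in> grade_0n"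
proof
  assume sub: "f ` grade_0n \<subseteq> grade_0n"
  have "1 *s 1 + 0 *s \<omega> \<in> grade_0n" "0 *s 1 + 1 *s \<omega> \<in> grade_0n"
    unfolding grade_0n_iff by blast+
  then show "f 1 \<in> grade_0n \<and> f \<omega> \<in> grade_0n"
    using sub by auto
next
  assume f: "f 1 \<in> grade_0n \<and> f \<omega> \<in> grade_0n"
  then obtain a b c d where f: "f 1 = a *s 1 + b *s \<omega>" "f \<omega> = c *s 1 + d *s \<omega>"
    unfolding grade_0n_iff by blast
  have "f (\<alpha> *s 1 + \<beta> *s \<omega>) = (\<alpha> * a + \<beta> * c) *s 1 + (\<alpha> * b + \<beta> * d) *s \<omega>" for \<alpha> \<beta>
    by (simp add: assms f scale_right_distrib scale_left_distrib add_ac)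
  then have "f (\<alpha> *s 1 + \<beta> *s \<omega>) \<in> grade_0n" for \<alpha> \<beta>
    unfolding grade_0n_iff by blast
  then show "f ` grade_0n \<subseteq> grade_0n"
    by (auto dest!: grade_0n_iff[THEN iffD1])
qed

lemma one_in_grade_0n: "1 \<in> grade_0n" and pseudoscalar_in_grade_0n: "\<omega> \<in> grade_0n"
  unfolding grade_0n_iff by (rule exI[of _ 1], rule exI[of _ 0], simp,
      rule exI[of _ 0], rule exI[of _ 1], simp)

lemma Gamma_0n_iff:
  "T \<in> Gamma_0n \<longleftrightarrow> ring_unit T \<and> T * \<omega> * ring_inv T \<in> grade_0n"
proof -
  have "ad T ` grade_0n \<subseteq> grade_0n \<longleftrightarrow> ad T 1 \<in> grade_0n \<and> ad T \<omega> \<in> grade_0n"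
    by (rule image_grade_0n_subset_iff)
      (simp_all add: ad_def distrib_left distrib_right scale_mult_left scale_mult_right)
  moreover have "ring_unit T \<Longrightarrow> ad T 1 \<in> grade_0n"
    by (simp add: ad_def ring_inv_right one_in_grade_0n)
  ultimately show ?thesis
    unfolding Gamma_0n_def units_in_def by (auto simp: ad_def)
qed

lemma Gamma_0n_eq_Gamma_n: "Gamma_0n = Gamma_n"
proof
  show "Gamma_n \<subseteq> Gamma_0n"
  proof
    fix T assume "T \<in> Gamma_n"
    then obtain \<beta> where "ring_unit T" "T * \<omega> * ring_inv T = 0 *s 1 + \<beta> *s \<omega>"
      unfolding Gamma_n_iff by auto
    then show "T \<in> Gamma_0n"
      unfolding Gamma_0n_iff grade_0n_iff by blast
  qed
  show "Gamma_0n \<subseteq> Gamma_n"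
  proof
    fix T assume "T \<in> Gamma_0n"
    then obtain \<alpha> \<beta> where T: "ring_unit T" and eq: "T * \<omega> * ring_inv T = \<alpha> *s 1 + \<beta> *s \<omega>"
      unfolding Gamma_0n_iff grade_0n_iff by blast
    obtain d where d: "\<omega> * \<omega> = d *s 1"
      using pseudoscalar_square by blast
    text \<open>Conjugation preserves the scalar \<open>\<omega>\<^sup>2\<close>, so the mixed term of the square vanishes.\<close>
    have "(T * \<omega> * ring_inv T) * (T * \<omega> * ring_inv T) = T * (\<omega> * \<omega>) * ring_inv T"
      by (simp add: mult.assoc ring_inv_left_assoc T)
    also have "\<dots> = d *s 1"
      by (simp add: d scale_mult_left scale_mult_right ring_inv_right T)
    finally have "(\<alpha> *s 1 + \<beta> *s \<omega>) * (\<alpha> *s 1 + \<beta> *s \<omega>) = d *s 1"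
      unfolding eq .
    then have "(\<alpha> * \<alpha> + \<beta> * \<beta> * d) *s 1 + (2 * \<alpha> * \<beta>) *s \<omega> = d *s 1"
      unfolding scalar_pseudoscalar_square[OF d] .
    then have "(\<alpha> * \<alpha> + \<beta> * \<beta> * d - d) *s 1 + (2 * \<alpha> * \<beta>) *s \<omega> = 0"
      unfolding scale_left_diff_distrib by (simp add: algebra_simps)
    then have "\<alpha> * \<beta> = 0"
      using scalar_pseudoscalar_eq_0_iff two_neq_zero by auto
    \<comment> \<open>Scalars are fixed by conjugation, so a scalar conjugate would make \<omega>
      itself a scalar.\<close>
    moreover have "\<beta> \<noteq> 0"
    proof
      assume "\<beta> = 0"
      then have "T * \<omega> * ring_inv T = \<alpha> *s 1"
        using eq by simp
      then have "T * \<omega> = T * (\<alpha> *s 1)"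
        using ring_unit_mult_eq_iff[OF T, of "T * \<omega>"] by (simp add: scale_mult_left scale_mult_right)
      then have "\<omega> = \<alpha> *s 1"
        using T by (metis ring_inv_left_assoc)
      then show False
        using scalar_pseudoscalar_eq_0_iff[of "- \<alpha>" 1] by simp
    qed
    ultimately show "T \<in> Gamma_n"
      using T eq unfolding Gamma_n_iff by auto
  qed
qed

lemma Gamma_n_of_odd:
  assumes "odd n"
  shows "Gamma_n = units_in UNIV"
proof -
  have "T * \<omega> * ring_inv T = 1 *s \<omega>" if "ring_unit T" for T
    using that pseudoscalar_commute[OF assms, of T] by (simp add: ring_unit_mult_eq_iff)
  then show ?thesis
    unfolding Gamma_n_iff set_eq_iff units_in_def by blast
qed

lemma hat_diff_scale_in_null_ideal_iff:
  "T - c *s hat T \<in> null_ideal \<longleftrightarrow> hat T - c *s T \<in> null_ideal"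
  using null_power_hat[of "T - c *s hat T"] null_power_hat[of "hat T - c *s T"] by auto

text \<open>Moving \<open>\<omega>\<close> past \<open>T\<close> turns the stabilizer condition into
  \<open>(T - c *s hat T) * \<omega> = 0\<close>. The annihilator of \<open>\<omega>\<close> is the
  radical, so this is the description of \<open>P_pm_rad\<close> up to applying
  \<open>hat\<close>.\<close>

lemma Gamma_n_of_even:
  assumes "even n"
  shows "Gamma_n = P_pm_rad"
proof (rule set_eqI)
  fix T
  have "T * \<omega> * ring_inv T = c *s \<omega> \<longleftrightarrow> hat T - c *s T \<in> null_ideal" if T: "ring_unit T" for c
  proof -
    have "T * \<omega> * ring_inv T = c *s \<omega> \<longleftrightarrow> T * \<omega> = (c *s \<omega>) * T"
      by (rule ring_unit_mult_eq_iff[OF T])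
    also have "\<dots> \<longleftrightarrow> (T - c *s hat T) * \<omega> = 0"
      by (simp add: scale_mult_left pseudoscalar_commute_hat[OF assms] left_diff_distrib)
    finally show ?thesis
      unfolding mult_pseudoscalar_eq_0_iff hat_diff_scale_in_null_ideal_iff .
  qed
  then show "T \<in> Gamma_n \<longleftrightarrow> T \<in> P_pm_rad"
    unfolding Gamma_n_iff P_pm_rad_iff by blast
qed

lemma grade_0n_mult_unit_iff:
  assumes "ring_unit T"
  shows "U * ring_inv T \<in> grade_0n \<longleftrightarrow> (\<exists>\<alpha> \<beta>. U = (\<alpha> *s 1 + \<beta> *s \<omega>) * T)"
  unfolding grade_0n_iff ring_unit_mult_eq_iff[OF assms] ..

lemma grade_0n_mult_pseudoscalar:
  assumes "U \<in> grade_0n"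
  shows "U * \<omega> \<in> grade_0n"
proof -
  obtain \<alpha> \<beta> d where "U = \<alpha> *s 1 + \<beta> *s \<omega>" "\<omega> * \<omega> = d *s 1"
    using assms pseudoscalar_square unfolding grade_0n_iff by blast
  then have "U * \<omega> = (\<beta> * d) *s 1 + \<alpha> *s \<omega>"
    by (simp add: distrib_right scale_mult_left add.commute)
  then show ?thesis
    unfolding grade_0n_iff by blast
qed

text \<open>The condition on \<open>1\<close> is the relation that describes \<open>P\<close>, and
  it implies the condition on \<open>\<omega>\<close>: the latter is fixed for even
  \<open>n\<close>, and for odd \<open>n\<close> its image is that of \<open>1\<close> times
  \<open>\<omega>\<close>.\<close>

lemma Gamma_check_0n_eq: "Gamma_check_0n = P"
proof (rule set_eqI)
  fix T
  have "ad_check T ` grade_0n \<subseteq> grade_0n \<longleftrightarrow> ad_check T 1 \<in> grade_0n \<and> ad_check T \<omega> \<in> grade_0n"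
    by (rule image_grade_0n_subset_iff)
      (simp_all add: ad_check_def distrib_left distrib_right scale_mult_left scale_mult_right)
  moreover have "ad_check T \<omega> \<in> grade_0n" if T: "ring_unit T" and 1: "ad_check T 1 \<in> grade_0n"
  proof (cases "even n")
    case True
    then have "ad_check T \<omega> = \<omega>"
      using T pseudoscalar_commute_hat[of T] by (simp add: ad_check_def ring_unit_mult_eq_iff)
    then show ?thesis
      by (simp add: pseudoscalar_in_grade_0n)
  next
    case False
    then have "ad_check T \<omega> = ad_check T 1 * \<omega>"
      using pseudoscalar_commute[of "ring_inv T"] by (simp add: ad_check_def mult.assoc)
    then show ?thesis
      using 1 grade_0n_mult_pseudoscalar by simp
  qed
  ultimately show "T \<in> Gamma_check_0n \<longleftrightarrow> T \<in> P"
    unfolding Gamma_check_0n_def units_in_def P_iff_hat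
    using grade_0n_mult_unit_iff[of T "hat T"] by (auto simp: ad_check_def)
qed

text \<open>The map fixes \<open>1\<close>, and on \<open>\<omega>\<close>, which is homogeneous of
  the parity of \<open>n\<close>, it acts as \<open>ad\<close> or as
  \<open>ad_check\<close>.\<close>

lemma Gamma_tilde_0n_iff:
  "T \<in> Gamma_tilde_0n \<longleftrightarrow> ring_unit T \<and>
    (if even n then T * \<omega> * ring_inv T else hat T * \<omega> * ring_inv T) \<in> grade_0n"
proof -
  have "ad_tilde T ` grade_0n \<subseteq> grade_0n \<longleftrightarrow> ad_tilde T 1 \<in> grade_0n \<and> ad_tilde T \<omega> \<in> grade_0n"
    by (rule image_grade_0n_subset_iff)
      (simp_all add: ad_tilde_def even_part_add odd_part_add even_part_scale odd_part_scale
        distrib_left distrib_right scale_mult_left scale_mult_right scale_right_distrib add_ac)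
  moreover have "ring_unit T \<Longrightarrow> ad_tilde T 1 = 1"
    by (simp add: ad_tilde_def even_part_of_even odd_part_of_even ring_inv_right)
  moreover have "ad_tilde T \<omega> = (if even n then T * \<omega> * ring_inv T else hat T * \<omega> * ring_inv T)"
    using hat_pseudoscalar
    by (simp add: ad_tilde_def even_part_of_even odd_part_of_even even_part_of_odd odd_part_of_odd)
  ultimately show ?thesis
    unfolding Gamma_tilde_0n_def units_in_def using one_in_grade_0n by auto
qed

lemma Gamma_tilde_0n_of_even:
  assumes "even n"
  shows "Gamma_tilde_0n = P_pm_rad"
  using assms Gamma_n_of_even Gamma_0n_eq_Gamma_n
  unfolding set_eq_iff Gamma_tilde_0n_iff Gamma_0n_iff by simp

text \<open>Here \<open>\<omega>\<close> is central and invertible, and multiplication by it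
  preserves \<open>grade_0n\<close>; cancelling it from the condition leaves the relation that
  describes \<open>P\<close>.\<close>

lemma Gamma_tilde_0n_of_odd_nondegenerate:
  assumes "odd n" "null_idx = {}"
  shows "Gamma_tilde_0n = P"
proof (rule set_eqI)
  fix T
  obtain d where d: "\<omega> * \<omega> = d *s 1" "d \<noteq> 0"
    using pseudoscalar_square assms(2) by blast
  have comm: "hat T * \<omega> * ring_inv T = hat T * ring_inv T * \<omega>"
    using pseudoscalar_commute[OF assms(1), of "ring_inv T"] by (simp add: mult.assoc)
  have "hat T * ring_inv T \<in> grade_0n" if asm: "hat T * \<omega> * ring_inv T \<in> grade_0n"
  proof -
    obtain \<alpha> \<beta> where "hat T * ring_inv T * \<omega> * \<omega> = \<alpha> *s 1 + \<beta> *s \<omega>"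
      using grade_0n_mult_pseudoscalar[OF asm] unfolding comm grade_0n_iff by blast
    then have "d *s (hat T * ring_inv T) = \<alpha> *s 1 + \<beta> *s \<omega>"
      by (simp add: mult.assoc d scale_mult_right)
    then have "(1 / d) *s (d *s (hat T * ring_inv T)) = (\<alpha> / d) *s 1 + (\<beta> / d) *s \<omega>"
      by (simp add: scale_right_distrib)
    then show ?thesis
      using d(2) unfolding grade_0n_iff by auto
  qed
  moreover have "hat T * \<omega> * ring_inv T \<in> grade_0n" if "hat T * ring_inv T \<in> grade_0n"
    unfolding comm using that by (rule grade_0n_mult_pseudoscalar)
  ultimately show "T \<in> Gamma_tilde_0n \<longleftrightarrow> T \<in> P"
    unfolding Gamma_tilde_0n_iff P_iff_hat
    using assms(1) grade_0n_mult_unit_iff[of T "hat T"] by auto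
qed

text \<open>Now \<open>\<omega>\<close> lies in the radical, which contains no unit. Hence the
  scalar term \<open>\<alpha> *s T\<close> must vanish, and the rest says that
  \<open>hat T - \<beta> *s T\<close> annihilates \<open>\<omega>\<close>.\<close>

lemma Gamma_tilde_0n_of_odd_degenerate:
  assumes n: "odd n" and null: "null_idx \<noteq> {}"
  shows "Gamma_tilde_0n = P_pm_rad"
proof (rule set_eqI)
  fix T
  have expand: "hat T * \<omega> = (\<alpha> *s 1 + \<beta> *s \<omega>) * T \<longleftrightarrow> (hat T - \<beta> *s T) * \<omega> = \<alpha> *s T" for \<alpha> \<beta>
    using pseudoscalar_commute[OF n, of T]
    by (simp add: distrib_right left_diff_distrib scale_mult_left diff_eq_eq)
  have "(\<exists>\<alpha> \<beta>. hat T * \<omega> = (\<alpha> *s 1 + \<beta> *s \<omega>) * T) \<longleftrightarrow> (\<exists>\<beta>. hat T - \<beta> *s T \<in> null_ideal)"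
    if T: "ring_unit T"
    unfolding expand
  proof
    assume "\<exists>\<alpha> \<beta>. (hat T - \<beta> *s T) * \<omega> = \<alpha> *s T"
    then obtain \<alpha> \<beta> where eq: "(hat T - \<beta> *s T) * \<omega> = \<alpha> *s T" by blast
    have "\<alpha> *s T \<in> null_ideal"
      unfolding eq[symmetric] by (intro null_ideal_mult_left pseudoscalar_in_null_ideal null)
    then have "\<alpha> = 0"
      using null_power_scale_iff ring_unit_notin_null_ideal[OF T] by blast
    then show "\<exists>\<beta>. hat T - \<beta> *s T \<in> null_ideal"
      using eq unfolding mult_pseudoscalar_eq_0_iff[symmetric] by auto
  next
    assume "\<exists>\<beta>. hat T - \<beta> *s T \<in> null_ideal"
    then show "\<exists>\<alpha> \<beta>. (hat T - \<beta> *s T) * \<omega> = \<alpha> *s T"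
      unfolding mult_pseudoscalar_eq_0_iff[symmetric] by (metis scale_zero_left)
  qed
  then show "T \<in> Gamma_tilde_0n \<longleftrightarrow> T \<in> P_pm_rad"
    unfolding Gamma_tilde_0n_iff P_pm_rad_iff
    using n grade_0n_mult_unit_iff[of T "hat T * \<omega>"] by auto
qed

lemma Gamma_groups:
  "Gamma_0n = Gamma_n \<and> Gamma_n = (if odd n then units_in UNIV else P_pm_rad) \<and>
   Gamma_check_0n = P \<and>
   Gamma_tilde_0n = (if odd n \<and> null_idx = {} then P else P_pm_rad)"
  using Gamma_0n_eq_Gamma_n Gamma_n_of_odd Gamma_n_of_even Gamma_check_0n_eq
    Gamma_tilde_0n_of_even Gamma_tilde_0n_of_odd_nondegenerate Gamma_tilde_0n_of_odd_degenerate
  by simp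

end

theorem theorem7p3:
  fixes p q r n :: nat
    and sR :: "real \<Rightarrow> 'a::ring_1 \<Rightarrow> 'a" and eR :: "nat \<Rightarrow> 'a"
    and sC :: "complex \<Rightarrow> 'b::ring_1 \<Rightarrow> 'b" and eC :: "nat \<Rightarrow> 'b"
  assumes "n = p + q + r" and "n \<ge> 1"
  shows
    "(geometric_algebra sR eR (real_metric p q) n \<longrightarrow>
       geometric_algebra.Gamma_0n sR eR n = geometric_algebra.Gamma_n sR eR n \<and>
       geometric_algebra.Gamma_n sR eR n =
         (if odd n then units_in UNIV else geometric_algebra.P_pm_rad sR eR n) \<and>
       geometric_algebra.Gamma_check_0n sR eR n = geometric_algebra.P sR eR n \<and>
       geometric_algebra.Gamma_tilde_0n sR eR n =
         (if odd n \<and> r = 0 then geometric_algebra.P sR eR n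
          else geometric_algebra.P_pm_rad sR eR n)) \<and>
     (geometric_algebra sC eC (complex_metric p q) n \<longrightarrow>
       geometric_algebra.Gamma_0n sC eC n = geometric_algebra.Gamma_n sC eC n \<and>
       geometric_algebra.Gamma_n sC eC n =
         (if odd n then units_in UNIV else geometric_algebra.P_pm_rad sC eC n) \<and>
       geometric_algebra.Gamma_check_0n sC eC n = geometric_algebra.P sC eC n \<and>
       geometric_algebra.Gamma_tilde_0n sC eC n =
         (if odd n \<and> r = 0 then geometric_algebra.P sC eC n
          else geometric_algebra.P_pm_rad sC eC n))"
proof ((rule conjI; rule impI), goal_cases)
  case 1
  then interpret geometric_algebra sR eR "real_metric p q" n .
  interpret geometric_algebra_char_not_2 sR eR "real_metric p q" n
    by unfold_locales (use assms in auto)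
  \<comment> \<open>The null generators are the last \<open>r\<close> ones, so the nondegenerate
    case is \<open>r = 0\<close>.\<close>
  have "null_idx = {p + q<..n}"
    unfolding null_idx_def real_metric_def using assms(1) by auto
  then have "null_idx = {} \<longleftrightarrow> r = 0"
    using assms(1) by auto
  then show ?case
    using Gamma_groups by simp
next
  case 2
  then interpret geometric_algebra sC eC "complex_metric p q" n .
  interpret geometric_algebra_char_not_2 sC eC "complex_metric p q" n
    by unfold_locales (use assms in auto)
  have "null_idx = {p + q<..n}"
    unfolding null_idx_def complex_metric_def using assms(1) by auto
  then have "null_idx = {} \<longleftrightarrow> r = 0"
    using assms(1) by auto
  then show ?case
    using Gamma_groups by simp
qed

end
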